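(* Let $\mathcal{A}$ be an amenable Banach algebra and let $\mathcal{I}$ be a closed left ideal in $\mathcal{A}$ which has a bounded two-sided approximate identity. Then $\mathcal{I}$ is amenable.
   Context: A Banach algebra $\mathcal{A}$ is amenable if for every Banach $\mathcal{A}$-bimodule $Z$, every continuous derivation $D:\mathcal{A}\to Z^*$ is inner, i.e. of the form $a\mapsto a\cdot z^*-z^*\cdot a$ for some $z^*\in Z^*$. Here $Z^*$ carries the dual module actions $\langle a\cdot z^*,z\rangle=\langle z^*,z\cdot a\rangle$, $\langle z^*\cdot a,z\rangle=\langle z^*,a\cdot z\rangle$, and a derivation is a linear map with $D(ab)=a\cdot D(b)+D(a)\cdot b$. A bounded two-sided approximate identity of a Banach algebra $\mathcal{I}$ is a norm-bounded net $(e_\beta)$ in $\mathcal{I}$ with $e_\beta c\to c$ and $ce_\beta\to c$ for all $c\in\mathcal{I}$. *)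

theory Defs
  imports "HOL-Analysis.Analysis"
begin

section \<open>Banach algebras\<close>

(* The scalar field 'k is the real or the complex field: these are, up to isomorphism, the only
   instances of the sort {real_normed_field, heine_borel}. The type class structure of 'a only
   records the underlying real Banach algebra; no unit is assumed. *)
locale banach_algebra = vector_space scl
  for scl :: "'k::{real_normed_field,heine_borel} \<Rightarrow> 'a::{real_normed_algebra,banach} \<Rightarrow> 'a" +
  assumes scale_of_real: "scl (of_real r) x = r *\<^sub>R x"
    and norm_scale: "norm (scl c x) = norm c * norm x"
    and mult_scale_left: "scl c x * y = scl c (x * y)"
    and mult_scale_right: "x * scl c y = scl c (x * y)"

definition closed_left_ideal ::
    "('k::{real_normed_field,heine_borel} \<Rightarrow> 'a::{real_normed_algebra,banach} \<Rightarrow> 'a) \<Rightarrow> 'a set \<Rightarrow> bool"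
  where "closed_left_ideal scl I \<longleftrightarrow>
    module.subspace scl I \<and> closed I \<and> (\<forall>a. \<forall>x\<in>I. a * x \<in> I)"


section \<open>Bounded approximate identities\<close>

definition directed_set :: "'i set \<Rightarrow> ('i \<Rightarrow> 'i \<Rightarrow> bool) \<Rightarrow> bool" where
  "directed_set B le \<longleftrightarrow> B \<noteq> {} \<and> reflp_on B le \<and> transp_on B le \<and>
    (\<forall>x\<in>B. \<forall>y\<in>B. \<exists>z\<in>B. le x z \<and> le y z)"

(* Convergence along this filter is convergence of nets indexed by the directed set B. *)
definition net_filter :: "'i set \<Rightarrow> ('i \<Rightarrow> 'i \<Rightarrow> bool) \<Rightarrow> 'i filter" where
  "net_filter B le = (INF b\<in>B. principal {b'\<in>B. le b b'})"

definition bounded_approximate_identity ::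
    "'a::real_normed_algebra set \<Rightarrow> 'i set \<Rightarrow> ('i \<Rightarrow> 'i \<Rightarrow> bool) \<Rightarrow> ('i \<Rightarrow> 'a) \<Rightarrow> bool" where
  "bounded_approximate_identity I B le e \<longleftrightarrow>
    directed_set B le \<and> e ` B \<subseteq> I \<and> bounded (e ` B) \<and>
    (\<forall>c\<in>I. ((\<lambda>b. e b * c) \<longlongrightarrow> c) (net_filter B le) \<and> ((\<lambda>b. c * e b) \<longlongrightarrow> c) (net_filter B le))"


section \<open>Banach spaces and Banach bimodules on explicit carriers\<close>

(* A type carries at most one norm from its type classes, so quantifying over all Banach
   bimodules requires the structure of a bimodule to be explicit data. *)
record ('k, 'z) vspace =
  vcarrier :: "'z set"
  vadd :: "'z \<Rightarrow> 'z \<Rightarrow> 'z"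
  vzero :: 'z
  vscale :: "'k \<Rightarrow> 'z \<Rightarrow> 'z"
  vnorm :: "'z \<Rightarrow> real"

record ('k, 'a, 'z) bimod = "('k, 'z) vspace" +
  lact :: "'a \<Rightarrow> 'z \<Rightarrow> 'z"
  ract :: "'z \<Rightarrow> 'a \<Rightarrow> 'z"

definition vdiff :: "('k::real_normed_field, 'z, 'm) vspace_scheme \<Rightarrow> 'z \<Rightarrow> 'z \<Rightarrow> 'z" where
  "vdiff V x y = vadd V x (vscale V (- 1) y)"

(* The value off the carrier is irrelevant, but Metric_space requires a distance function that is
   nonnegative and symmetric on the whole type. *)
definition vdist :: "('k::real_normed_field, 'z, 'm) vspace_scheme \<Rightarrow> 'z \<Rightarrow> 'z \<Rightarrow> real" where
  "vdist V x y = (if x \<in> vcarrier V \<and> y \<in> vcarrier V then vnorm V (vdiff V x y) else 0)"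

locale banach_space =
  fixes V :: "('k::{real_normed_field,heine_borel}, 'z, 'm) vspace_scheme"
  assumes zero_closed: "vzero V \<in> vcarrier V"
    and add_closed: "\<lbrakk>x \<in> vcarrier V; y \<in> vcarrier V\<rbrakk> \<Longrightarrow> vadd V x y \<in> vcarrier V"
    and scale_closed: "x \<in> vcarrier V \<Longrightarrow> vscale V c x \<in> vcarrier V"
    and add_assoc: "\<lbrakk>x \<in> vcarrier V; y \<in> vcarrier V; z \<in> vcarrier V\<rbrakk> \<Longrightarrow>
          vadd V (vadd V x y) z = vadd V x (vadd V y z)"
    and add_commute: "\<lbrakk>x \<in> vcarrier V; y \<in> vcarrier V\<rbrakk> \<Longrightarrow> vadd V x y = vadd V y x"
    and add_zero: "x \<in> vcarrier V \<Longrightarrow> vadd V x (vzero V) = x"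
    and add_inverse: "x \<in> vcarrier V \<Longrightarrow> \<exists>y\<in>vcarrier V. vadd V x y = vzero V"
    and scale_add_right: "\<lbrakk>x \<in> vcarrier V; y \<in> vcarrier V\<rbrakk> \<Longrightarrow>
          vscale V c (vadd V x y) = vadd V (vscale V c x) (vscale V c y)"
    and scale_add_left: "x \<in> vcarrier V \<Longrightarrow>
          vscale V (c + d) x = vadd V (vscale V c x) (vscale V d x)"
    and scale_scale: "x \<in> vcarrier V \<Longrightarrow> vscale V c (vscale V d x) = vscale V (c * d) x"
    and scale_one: "x \<in> vcarrier V \<Longrightarrow> vscale V 1 x = x"
    and norm_nonneg: "x \<in> vcarrier V \<Longrightarrow> 0 \<le> vnorm V x"
    and norm_eq_zero: "x \<in> vcarrier V \<Longrightarrow> vnorm V x = 0 \<longleftrightarrow> x = vzero V"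
    and norm_triangle: "\<lbrakk>x \<in> vcarrier V; y \<in> vcarrier V\<rbrakk> \<Longrightarrow>
          vnorm V (vadd V x y) \<le> vnorm V x + vnorm V y"
    and norm_vscale: "x \<in> vcarrier V \<Longrightarrow> vnorm V (vscale V c x) = norm c * vnorm V x"
    and complete: "Metric_space.mcomplete (vcarrier V) (vdist V)"

(* S is a closed subalgebra of the ambient algebra, regarded as a Banach algebra in its own right;
   the actions are only constrained on S. *)
locale banach_bimodule = banach_space Z
  for scl :: "'k::{real_normed_field,heine_borel} \<Rightarrow> 'a::{real_normed_algebra,banach} \<Rightarrow> 'a"
    and S :: "'a set"
    and Z :: "('k, 'a, 'z) bimod" +
  assumes lact_closed: "\<lbrakk>a \<in> S; z \<in> vcarrier Z\<rbrakk> \<Longrightarrow> lact Z a z \<in> vcarrier Z"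
    and ract_closed: "\<lbrakk>a \<in> S; z \<in> vcarrier Z\<rbrakk> \<Longrightarrow> ract Z z a \<in> vcarrier Z"
    and lact_add_left: "\<lbrakk>a \<in> S; b \<in> S; z \<in> vcarrier Z\<rbrakk> \<Longrightarrow>
          lact Z (a + b) z = vadd Z (lact Z a z) (lact Z b z)"
    and lact_add_right: "\<lbrakk>a \<in> S; y \<in> vcarrier Z; z \<in> vcarrier Z\<rbrakk> \<Longrightarrow>
          lact Z a (vadd Z y z) = vadd Z (lact Z a y) (lact Z a z)"
    and lact_scale_left: "\<lbrakk>a \<in> S; z \<in> vcarrier Z\<rbrakk> \<Longrightarrow>
          lact Z (scl c a) z = vscale Z c (lact Z a z)"
    and lact_scale_right: "\<lbrakk>a \<in> S; z \<in> vcarrier Z\<rbrakk> \<Longrightarrow>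
          lact Z a (vscale Z c z) = vscale Z c (lact Z a z)"
    and ract_add_left: "\<lbrakk>a \<in> S; y \<in> vcarrier Z; z \<in> vcarrier Z\<rbrakk> \<Longrightarrow>
          ract Z (vadd Z y z) a = vadd Z (ract Z y a) (ract Z z a)"
    and ract_add_right: "\<lbrakk>a \<in> S; b \<in> S; z \<in> vcarrier Z\<rbrakk> \<Longrightarrow>
          ract Z z (a + b) = vadd Z (ract Z z a) (ract Z z b)"
    and ract_scale_left: "\<lbrakk>a \<in> S; z \<in> vcarrier Z\<rbrakk> \<Longrightarrow>
          ract Z (vscale Z c z) a = vscale Z c (ract Z z a)"
    and ract_scale_right: "\<lbrakk>a \<in> S; z \<in> vcarrier Z\<rbrakk> \<Longrightarrow>
          ract Z z (scl c a) = vscale Z c (ract Z z a)"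
    and lact_mult: "\<lbrakk>a \<in> S; b \<in> S; z \<in> vcarrier Z\<rbrakk> \<Longrightarrow> lact Z (a * b) z = lact Z a (lact Z b z)"
    and ract_mult: "\<lbrakk>a \<in> S; b \<in> S; z \<in> vcarrier Z\<rbrakk> \<Longrightarrow> ract Z z (a * b) = ract Z (ract Z z a) b"
    and lact_ract: "\<lbrakk>a \<in> S; b \<in> S; z \<in> vcarrier Z\<rbrakk> \<Longrightarrow>
          lact Z a (ract Z z b) = ract Z (lact Z a z) b"
    and lact_bounded: "\<exists>K. \<forall>a\<in>S. \<forall>z\<in>vcarrier Z. vnorm Z (lact Z a z) \<le> K * norm a * vnorm Z z"
    and ract_bounded: "\<exists>K. \<forall>a\<in>S. \<forall>z\<in>vcarrier Z. vnorm Z (ract Z z a) \<le> K * norm a * vnorm Z z"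


section \<open>Dual bimodules\<close>

(* Functionals are extensional functions, so that equality on the carrier
   is equality in HOL. *)
definition bounded_functionals ::
    "('k::real_normed_field, 'z, 'm) vspace_scheme \<Rightarrow> ('z \<Rightarrow> 'k) set" where
  "bounded_functionals V = {f \<in> extensional (vcarrier V).
     (\<forall>x\<in>vcarrier V. \<forall>y\<in>vcarrier V. f (vadd V x y) = f x + f y) \<and>
     (\<forall>c. \<forall>x\<in>vcarrier V. f (vscale V c x) = c * f x) \<and>
     (\<exists>K. \<forall>x\<in>vcarrier V. norm (f x) \<le> K * vnorm V x)}"

definition dual_bimodule ::
    "('k::real_normed_field, 'a, 'z) bimod \<Rightarrow> ('k, 'a, 'z \<Rightarrow> 'k) bimod" where
  "dual_bimodule Z =
    \<lparr>vcarrier = bounded_functionals Z,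
     vadd = (\<lambda>f g. \<lambda>z\<in>vcarrier Z. f z + g z),
     vzero = (\<lambda>z\<in>vcarrier Z. 0),
     vscale = (\<lambda>c f. \<lambda>z\<in>vcarrier Z. c * f z),
     vnorm = (\<lambda>f. SUP z\<in>{z \<in> vcarrier Z. vnorm Z z \<le> 1}. norm (f z)),
     lact = (\<lambda>a f. \<lambda>z\<in>vcarrier Z. f (ract Z z a)),
     ract = (\<lambda>f a. \<lambda>z\<in>vcarrier Z. f (lact Z a z))\<rparr>"


section \<open>Derivations and amenability\<close>

definition continuous_derivation ::
    "('k::real_normed_field \<Rightarrow> 'a::real_normed_algebra \<Rightarrow> 'a) \<Rightarrow> 'a set \<Rightarrow>
     ('k, 'a, 'w) bimod \<Rightarrow> ('a \<Rightarrow> 'w) \<Rightarrow> bool" where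
  "continuous_derivation scl S W D \<longleftrightarrow>
     (\<forall>a\<in>S. D a \<in> vcarrier W) \<and>
     (\<forall>a\<in>S. \<forall>b\<in>S. D (a + b) = vadd W (D a) (D b)) \<and>
     (\<forall>c. \<forall>a\<in>S. D (scl c a) = vscale W c (D a)) \<and>
     (\<forall>a\<in>S. \<forall>b\<in>S. D (a * b) = vadd W (lact W a (D b)) (ract W (D a) b)) \<and>
     continuous_map (top_of_set S) (Metric_space.mtopology (vcarrier W) (vdist W)) D"

definition inner_derivation ::
    "'a set \<Rightarrow> ('k::real_normed_field, 'a, 'w) bimod \<Rightarrow> ('a \<Rightarrow> 'w) \<Rightarrow> bool" where
  "inner_derivation S W D \<longleftrightarrow>
     (\<exists>w\<in>vcarrier W. \<forall>a\<in>S. D a = vdiff W (lact W a w) (ract W w a))"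

(* Amenability of the closed subalgebra S, for bimodules whose elements are drawn from the type 'z.
   HOL cannot quantify over 'z inside a formula: amenability proper is amenable_over for every
   type 'z. *)
definition amenable_over ::
    "'z itself \<Rightarrow> ('k::{real_normed_field,heine_borel} \<Rightarrow> 'a::{real_normed_algebra,banach} \<Rightarrow> 'a) \<Rightarrow>
     'a set \<Rightarrow> bool" where
  "amenable_over (T::'z itself) scl S \<longleftrightarrow>
     (\<forall>(Z::('k, 'a, 'z) bimod) D.
        banach_bimodule scl S Z \<longrightarrow> continuous_derivation scl S (dual_bimodule Z) D \<longrightarrow>
        inner_derivation S (dual_bimodule Z) D)"

(* A concrete universe for the bimodules of an algebra 'a. It has 2 ^ |'a \<times> 'k| elements, so (up to
   isomorphism) every bimodule of at most that cardinality lives in it, among them the bimodules of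
   bounded bilinear forms on the unitization. *)
type_synonym ('k, 'a) bimod_universe = "'a \<times> 'k \<Rightarrow> 'a \<times> 'k \<Rightarrow> 'k"

end

theory Submission
  imports Defs
begin

text \<open>
  The proof averages over a virtual diagonal of \<open>A\<close>, restricted to \<open>I\<close> by the approximate identity.

  Write \<open>A\<^sup>#\<close> for the unitization of \<open>A\<close> and suppose first that \<open>A\<close> had a bounded approximate
  diagonal \<open>m = \<Sum> a\<^sub>i \<otimes> b\<^sub>i\<close>. Because \<open>I\<close> is a left ideal, \<open>a\<^sub>i e\<close> and \<open>b\<^sub>i e'\<close> lie in \<open>I\<close> for members
  \<open>e\<close>, \<open>e'\<close> of the approximate identity, so \<open>\<Sum> a\<^sub>i e \<otimes> b\<^sub>i e'\<close> is a candidate for an approximate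
  diagonal of \<open>I\<close>. It is one if the limits are taken first over \<open>e'\<close>, then over \<open>e\<close>, and over \<open>m\<close> last.
  It commutes with \<open>c \<in> I\<close> because \<open>c e'\<close> and \<open>e' c\<close> both approach \<open>c\<close>, and \<open>a\<^sub>i e b\<^sub>i e' c\<close> approaches
  \<open>a\<^sub>i e b\<^sub>i c\<close> and then \<open>a\<^sub>i b\<^sub>i c\<close>, where \<open>b\<^sub>i c \<in> I\<close>.

  Tensor products do not occur below: the diagonal is a functional \<open>M\<close> on bounded bilinear forms on
  \<open>A\<^sup>#\<close>, to be thought of as \<open>\<phi> \<mapsto> lim \<Sum> \<phi> a\<^sub>i b\<^sub>i\<close>. For a derivation \<open>D\<close> from \<open>I\<close> into \<open>Z\<^sup>*\<close> and
  \<open>z \<in> Z\<close> there are the forms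
    \<open>\<phi>\<^sub>z p q = lim\<^sub>e lim\<^sub>e\<^sub>' \<langle>D (q e'), z \<cdot> (p e)\<rangle>\<close> and \<open>\<theta>\<^sub>z p q = lim\<^sub>e lim\<^sub>e\<^sub>' \<langle>D (p e q e'), z\<rangle>\<close>,
  the limits being taken along an ultrafilter that refines the net, so that they exist and are linear.
  With \<open>w z = M \<phi>\<^sub>z\<close> and \<open>v z = M \<theta>\<^sub>z\<close> the derivation rule gives \<open>D c = c \<cdot> w - w \<cdot> c + v \<cdot> c\<close>
  (lemma \<open>derivation_as_diagonal_average\<close>). The defect \<open>v\<close> is there because \<open>Z\<close> may be degenerate; it is
  harmless: \<open>c \<mapsto> v \<cdot> c\<close> is again a derivation, which forces \<open>c' \<cdot> v \<cdot> c = 0\<close>, and then it is the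
  inner derivation given by \<open>u - v\<close>, \<open>u\<close> being the weak* limit of \<open>e \<cdot> v\<close> (lemma
  \<open>derivation_is_inner\<close>).

  The functional \<open>M\<close> comes from the amenability of \<open>A\<close>, applied to a single derivation
  (lemma \<open>amenable_imp_virtual_diagonal\<close>). The usual choice is \<open>c \<mapsto> (1 \<otimes> 1) \<cdot> c - c \<cdot> (1 \<otimes> 1)\<close>,
  with values in the second dual of the kernel of the multiplication \<open>A\<^sup># \<otimes> A\<^sup># \<rightarrow> A\<^sup>#\<close>. The predual of
  that bimodule is a quotient of the space of bilinear forms; here it is represented by the forms
  that vanish when the second argument is \<open>1\<close>.
\<close>

section \<open>Limits along ultrafilters\<close>

definition ultrafilter :: "'i filter \<Rightarrow> bool" where
  "ultrafilter U \<longleftrightarrow> U \<noteq> bot \<and> (\<forall>P. eventually P U \<or> eventually (\<lambda>x. \<not> P x) U)"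

text \<open>By Zorn's lemma: a proper filter that is minimal below the given one decides every predicate, since
  otherwise it could be refined by adding that predicate.\<close>
lemma ultrafilter_below:
  assumes "F \<noteq> bot"
  shows "\<exists>U\<le>F. ultrafilter U"
proof -
  let ?A = "{G. G \<le> F \<and> G \<noteq> bot}"
  have po: "partial_order_on ?A (relation_of (\<ge>) ?A)"
    by (rule partial_order_on_relation_ofI) auto
  have "\<exists>m\<in>?A. \<forall>a\<in>?A. a \<le> m \<longrightarrow> a = m"
  proof (rule predicate_Zorn[OF po])
    fix C assume C: "C \<in> Chains (relation_of (\<ge>) ?A)"
    show "\<exists>u\<in>?A. \<forall>a\<in>C. u \<le> a"
    proof (cases "C = {}")
      case True
      then show ?thesis using assms by auto
    next
      case False
      have sub: "C \<subseteq> ?A" and lin: "\<And>a b. a \<in> C \<Longrightarrow> b \<in> C \<Longrightarrow> a \<le> b \<or> b \<le> a"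
        using C by (auto simp: Chains_def relation_of_def)
      obtain G where "G \<in> C" using False by blast
      then have le: "Inf C \<le> F" using sub Inf_lower[of G C] order_trans[of "Inf C" G F] by blast
      have "Inf C \<noteq> bot"
      proof
        assume "Inf C = bot"
        then have "eventually (\<lambda>x. False) (Inf C)" by simp
        moreover have "eventually (\<lambda>x. False) (Inf C) \<longleftrightarrow> (\<exists>b\<in>C. eventually (\<lambda>x. False) b)"
        proof (rule eventually_Inf_base[OF False])
          fix F G assume "F \<in> C" "G \<in> C"
          with lin[of F G] show "\<exists>x\<in>C. x \<le> inf F G" by (meson le_inf_iff order_refl)
        qed
        ultimately obtain b where "b \<in> C" "eventually (\<lambda>x. False) b" by blast
        then have "b = bot" "b \<noteq> bot" using sub by (simp_all add: trivial_limit_def subset_eq)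
        then show False by blast
      qed
      with le have "Inf C \<in> ?A" by simp
      then show ?thesis by (intro bexI[of _ "Inf C"] ballI Inf_lower)
    qed
  qed
  then obtain U where U: "U \<le> F" "U \<noteq> bot" and min: "\<And>G. G \<le> F \<Longrightarrow> G \<noteq> bot \<Longrightarrow> G \<le> U \<Longrightarrow> G = U"
    by auto
  have "eventually P U \<or> eventually (\<lambda>x. \<not> P x) U" for P
  proof (rule ccontr)
    assume n: "\<not> ?thesis"
    have "inf U (principal {x. P x}) \<noteq> bot"
      using n by (auto simp: trivial_limit_def eventually_inf_principal)
    then have "inf U (principal {x. P x}) = U"
      using U by (intro min) (auto intro: le_infI1)
    moreover have "eventually P (inf U (principal {x. P x}))"
      by (simp add: eventually_inf_principal)
    ultimately have "eventually P U" by simp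
    with n show False by blast
  qed
  with U show ?thesis by (auto simp: ultrafilter_def)
qed

text \<open>Closed balls of the scalar field are compact, so a bounded family has a cluster point along the
  ultrafilter, and an ultrafilter converges to each of its cluster points.\<close>
lemma ultrafilter_tendsto_Lim:
  fixes f :: "'i \<Rightarrow> 'k::{real_normed_field,heine_borel}"
  assumes U: "ultrafilter U" and bd: "\<And>b. norm (f b) \<le> K"
  shows "(f \<longlongrightarrow> Lim U f) U"
proof -
  have nb: "U \<noteq> bot" using U by (simp add: ultrafilter_def)
  have "\<exists>x\<in>cball 0 K. inf (nhds x) (filtermap f U) \<noteq> bot"
    using compact_cball[of "0::'k" K] bd nb
    unfolding compact_filter by (auto simp: filtermap_bot_iff eventually_filtermap)
  then obtain l where l: "inf (nhds l) (filtermap f U) \<noteq> bot" by blast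
  have "(f \<longlongrightarrow> l) U"
  proof (rule topological_tendstoI)
    fix S assume S: "open S" "l \<in> S"
    show "eventually (\<lambda>x. f x \<in> S) U"
    proof (rule ccontr)
      assume "\<not> ?thesis"
      then have "eventually (\<lambda>x. f x \<notin> S) U"
        using U by (auto simp: ultrafilter_def)
      then have "eventually (\<lambda>y. y \<notin> S) (filtermap f U)" by (simp add: eventually_filtermap)
      moreover have "eventually (\<lambda>y. y \<in> S) (nhds l)" using S by (rule eventually_nhds_in_open)
      ultimately have "eventually (\<lambda>y. False) (inf (nhds l) (filtermap f U))"
        unfolding eventually_inf by fast
      with l show False by (simp add: trivial_limit_def)
    qed
  qed
  then show ?thesis using tendsto_Lim[OF nb] by metis
qed

text \<open>The inner limit is the one over the second index. In the application it lets \<open>e'\<close>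
  run to its limit before \<open>e\<close> does.\<close>
definition double_Lim :: "'i filter \<Rightarrow> ('i \<Rightarrow> 'i \<Rightarrow> 'k::real_normed_field) \<Rightarrow> 'k" where
  "double_Lim U h = Lim U (\<lambda>b. Lim U (h b))"

context
  fixes U :: "'i filter"
  assumes U: "ultrafilter U"
begin

lemma norm_Lim_le:
  fixes f :: "'i \<Rightarrow> 'k::{real_normed_field,heine_borel}"
  assumes "\<And>b. norm (f b) \<le> K"
  shows "norm (Lim U f) \<le> K"
proof (rule tendsto_upperbound)
  show "((\<lambda>b. norm (f b)) \<longlongrightarrow> norm (Lim U f)) U"
    by (rule tendsto_norm[OF ultrafilter_tendsto_Lim[OF U assms]])
qed (use U assms in \<open>auto simp: ultrafilter_def\<close>)

lemma Lim_add:
  fixes f :: "'i \<Rightarrow> 'k::{real_normed_field,heine_borel}"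
  assumes "\<And>b. norm (f b) \<le> K" "\<And>b. norm (g b) \<le> L"
  shows "Lim U (\<lambda>b. f b + g b) = Lim U f + Lim U g"
  using U ultrafilter_tendsto_Lim[OF U, of f, OF assms(1)] ultrafilter_tendsto_Lim[OF U, of g, OF assms(2)]
  by (intro tendsto_Lim tendsto_add) (auto simp: ultrafilter_def)

lemma Lim_mult:
  fixes f :: "'i \<Rightarrow> 'k::{real_normed_field,heine_borel}"
  assumes "\<And>b. norm (f b) \<le> K"
  shows "Lim U (\<lambda>b. c * f b) = c * Lim U f"
  using U ultrafilter_tendsto_Lim[OF U, of f, OF assms(1)]
  by (intro tendsto_Lim tendsto_mult tendsto_const) (auto simp: ultrafilter_def)

lemma double_Lim_add:
  fixes f :: "'i \<Rightarrow> 'i \<Rightarrow> 'k::{real_normed_field,heine_borel}"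
  assumes "\<And>b b'. norm (f b b') \<le> K" "\<And>b b'. norm (g b b') \<le> L"
  shows "double_Lim U (\<lambda>b b'. f b b' + g b b') = double_Lim U f + double_Lim U g"
  unfolding double_Lim_def
  by (simp add: Lim_add[OF assms] Lim_add[OF norm_Lim_le[OF assms(1)] norm_Lim_le[OF assms(2)]])

lemma double_Lim_mult:
  fixes f :: "'i \<Rightarrow> 'i \<Rightarrow> 'k::{real_normed_field,heine_borel}"
  assumes "\<And>b b'. norm (f b b') \<le> K"
  shows "double_Lim U (\<lambda>b b'. c * f b b') = c * double_Lim U f"
  unfolding double_Lim_def by (simp add: Lim_mult[OF assms] Lim_mult[OF norm_Lim_le[OF assms]])

lemma norm_double_Lim_le:
  fixes f :: "'i \<Rightarrow> 'i \<Rightarrow> 'k::{real_normed_field,heine_borel}"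
  assumes "\<And>b b'. norm (f b b') \<le> K"
  shows "norm (double_Lim U f) \<le> K"
  unfolding double_Lim_def by (intro norm_Lim_le assms)

lemma double_Lim_eqI:
  fixes f :: "'i \<Rightarrow> 'i \<Rightarrow> 'k::{real_normed_field,heine_borel}"
  assumes "\<And>b. (f b \<longlongrightarrow> g b) U" "(g \<longlongrightarrow> l) U"
  shows "double_Lim U f = l"
proof -
  have nb: "U \<noteq> bot" using U by (simp add: ultrafilter_def)
  have "Lim U (f b) = g b" for b by (rule tendsto_Lim[OF nb assms(1)])
  then show ?thesis unfolding double_Lim_def using tendsto_Lim[OF nb assms(2)] by simp
qed

end

section \<open>Normed spaces of functions with the supremum norm\<close>

text \<open>Both dual spaces and spaces of bilinear forms are spaces of functions, normed by the supremum of
  the values on a set \<open>X\<close> of test points. Since the values on \<open>X\<close> determine an element, every identity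
  between elements can be checked pointwise, in the scalar field.\<close>
locale evaluation_space =
  fixes V :: "('k::{real_normed_field,heine_borel}, 'w, 'm) vspace_scheme"
    and ev :: "'w \<Rightarrow> 'x \<Rightarrow> 'k" and X :: "'x set"
  assumes X: "X \<noteq> {}"
    and zero_mem: "vzero V \<in> vcarrier V"
    and add_mem: "\<lbrakk>f \<in> vcarrier V; g \<in> vcarrier V\<rbrakk> \<Longrightarrow> vadd V f g \<in> vcarrier V"
    and scale_mem: "f \<in> vcarrier V \<Longrightarrow> vscale V c f \<in> vcarrier V"
    and ev_zero: "x \<in> X \<Longrightarrow> ev (vzero V) x = 0"
    and ev_add: "\<lbrakk>f \<in> vcarrier V; g \<in> vcarrier V; x \<in> X\<rbrakk> \<Longrightarrow> ev (vadd V f g) x = ev f x + ev g x"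
    and ev_scale: "\<lbrakk>f \<in> vcarrier V; x \<in> X\<rbrakk> \<Longrightarrow> ev (vscale V c f) x = c * ev f x"
    and ev_inj: "\<lbrakk>f \<in> vcarrier V; g \<in> vcarrier V; \<And>x. x \<in> X \<Longrightarrow> ev f x = ev g x\<rbrakk> \<Longrightarrow> f = g"
    and ev_bdd: "f \<in> vcarrier V \<Longrightarrow> bdd_above ((\<lambda>x. norm (ev f x)) ` X)"
    and vnorm_eq: "f \<in> vcarrier V \<Longrightarrow> vnorm V f = (SUP x\<in>X. norm (ev f x))"
begin

lemma ev_le_norm: "f \<in> vcarrier V \<Longrightarrow> x \<in> X \<Longrightarrow> norm (ev f x) \<le> vnorm V f"
  using cSUP_upper[OF _ ev_bdd] by (simp add: vnorm_eq)

lemma norm_leI: "f \<in> vcarrier V \<Longrightarrow> (\<And>x. x \<in> X \<Longrightarrow> norm (ev f x) \<le> K) \<Longrightarrow> vnorm V f \<le> K"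
  by (simp add: vnorm_eq cSUP_least X)

lemma vnorm_nonneg: "f \<in> vcarrier V \<Longrightarrow> 0 \<le> vnorm V f"
  using X ev_le_norm norm_ge_zero order_trans by blast

lemma diff_closed: "\<lbrakk>f \<in> vcarrier V; g \<in> vcarrier V\<rbrakk> \<Longrightarrow> vdiff V f g \<in> vcarrier V"
  by (simp add: vdiff_def add_mem scale_mem)

lemma ev_diff:
  "\<lbrakk>f \<in> vcarrier V; g \<in> vcarrier V; x \<in> X\<rbrakk> \<Longrightarrow> ev (vdiff V f g) x = ev f x - ev g x"
  by (simp add: vdiff_def scale_mem ev_add ev_scale)

sublocale Metric_space "vcarrier V" "vdist V"
proof
  show "0 \<le> vdist V x y" for x y by (auto simp: vdist_def vnorm_nonneg diff_closed)
  have sym: "vdist V x y \<le> vdist V y x" if "x \<in> vcarrier V" "y \<in> vcarrier V" for x y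
    using that ev_le_norm[OF diff_closed, of y x]
    by (auto simp: vdist_def diff_closed ev_diff norm_minus_commute intro!: norm_leI)
  show "vdist V x y = vdist V y x" for x y
    using sym[of x y] sym[of y x] by (cases "x \<in> vcarrier V \<and> y \<in> vcarrier V") (auto simp: vdist_def)
  show "vdist V x y = 0 \<longleftrightarrow> x = y" if xy: "x \<in> vcarrier V" "y \<in> vcarrier V" for x y
  proof
    assume "vdist V x y = 0"
    then have "ev x s = ev y s" if "s \<in> X" for s
      using ev_le_norm[OF diff_closed[OF xy] that] xy that by (simp add: vdist_def ev_diff)
    then show "x = y" using ev_inj xy by blast
  next
    assume "x = y"
    then have "vdist V x y \<le> 0"
      using xy by (auto simp: vdist_def ev_diff intro!: norm_leI diff_closed)
    then show "vdist V x y = 0" using vnorm_nonneg[OF diff_closed[OF xy]] xy by (simp add: vdist_def)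
  qed
  show "vdist V x z \<le> vdist V x y + vdist V y z"
    if "x \<in> vcarrier V" "y \<in> vcarrier V" "z \<in> vcarrier V" for x y z
  proof -
    have "norm (ev (vdiff V x z) s) \<le> vnorm V (vdiff V x y) + vnorm V (vdiff V y z)" if s: "s \<in> X" for s
    proof -
      have "norm (ev (vdiff V x z) s) \<le> norm (ev (vdiff V x y) s) + norm (ev (vdiff V y z) s)"
        using norm_triangle_ineq[of "ev x s - ev y s" "ev y s - ev z s"] s \<open>x \<in> _\<close> \<open>y \<in> _\<close> \<open>z \<in> _\<close>
        by (simp add: ev_diff)
      with ev_le_norm[OF diff_closed s] \<open>x \<in> _\<close> \<open>y \<in> _\<close> \<open>z \<in> _\<close> show ?thesis
        by (meson add_mono order_trans)
    qed
    with that show ?thesis by (simp add: vdist_def norm_leI diff_closed)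
  qed
qed

lemma vnorm_triangle:
  "\<lbrakk>f \<in> vcarrier V; g \<in> vcarrier V\<rbrakk> \<Longrightarrow> vnorm V (vadd V f g) \<le> vnorm V f + vnorm V g"
  by (rule norm_leI) (auto simp: add_mem ev_add intro!: norm_triangle_le add_mono ev_le_norm)

lemma vnorm_scale_le:
  assumes f: "f \<in> vcarrier V"
  shows "vnorm V (vscale V c f) \<le> norm c * vnorm V f"
  using assms by (auto intro!: norm_leI mult_left_mono ev_le_norm simp: scale_mem ev_scale norm_mult)

lemma vnorm_scale:
  assumes f: "f \<in> vcarrier V"
  shows "vnorm V (vscale V c f) = norm c * vnorm V f"
proof (cases "c = 0")
  case True
  then show ?thesis
    using vnorm_scale_le[OF f, of c] vnorm_nonneg[OF scale_mem[OF f], of c] by simp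
next
  case False
  have "vscale V (inverse c) (vscale V c f) = f"
    using f False by (intro ev_inj) (auto simp: scale_mem ev_scale)
  then have "vnorm V f \<le> norm (inverse c) * vnorm V (vscale V c f)"
    using vnorm_scale_le[OF scale_mem[OF f], of "inverse c" c] by simp
  then have "norm c * vnorm V f \<le> norm c * (norm (inverse c) * vnorm V (vscale V c f))"
    by (intro mult_left_mono) auto
  also have "\<dots> = vnorm V (vscale V c f)"
    using False by (simp only: mult.assoc[symmetric] norm_mult[symmetric]) simp
  finally have "norm c * vnorm V f \<le> vnorm V (vscale V c f)" .
  with vnorm_scale_le[OF f, of c] show ?thesis by simp
qed

text \<open>A Cauchy sequence is norm bounded and converges pointwise on \<open>X\<close>; a member of the space with the
  pointwise limit as its values is then also the limit in norm. So completeness reduces to the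
  closure of the carrier under bounded pointwise limits.\<close>
lemma mcompleteI:
  assumes lim: "\<And>\<sigma> g K N. \<lbrakk>\<And>n. \<sigma> n \<in> vcarrier V; \<And>n. n \<ge> N \<Longrightarrow> vnorm V (\<sigma> n) \<le> K;
      \<And>x. x \<in> X \<Longrightarrow> (\<lambda>n. ev (\<sigma> n) x) \<longlonglongrightarrow> g x\<rbrakk> \<Longrightarrow> \<exists>f\<in>vcarrier V. \<forall>x\<in>X. ev f x = g x"
  shows mcomplete
  unfolding mcomplete_def
proof (intro allI impI)
  fix \<sigma> :: "nat \<Rightarrow> 'w" assume "MCauchy \<sigma>"
  then have mem: "\<sigma> n \<in> vcarrier V" for n by (auto simp: MCauchy_def)
  have cau: "\<exists>N. \<forall>n n'. N \<le> n \<longrightarrow> N \<le> n' \<longrightarrow> vdist V (\<sigma> n) (\<sigma> n') < \<epsilon>" if "\<epsilon> > 0" for \<epsilon>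
    using \<open>MCauchy \<sigma>\<close> that by (simp add: MCauchy_def)
  have ev_le: "norm (ev (\<sigma> n) x - ev (\<sigma> n') x) \<le> vdist V (\<sigma> n) (\<sigma> n')" if "x \<in> X" for n n' x
    using ev_le_norm[OF diff_closed[OF mem mem] that] that by (simp add: vdist_def mem ev_diff)
  have "convergent (\<lambda>n. ev (\<sigma> n) x)" if x: "x \<in> X" for x
  proof (rule Cauchy_convergent, rule CauchyI)
    fix \<epsilon> :: real assume "0 < \<epsilon>"
    then obtain N where "\<forall>n n'. N \<le> n \<longrightarrow> N \<le> n' \<longrightarrow> vdist V (\<sigma> n) (\<sigma> n') < \<epsilon>"
      using cau by blast
    then show "\<exists>N. \<forall>m\<ge>N. \<forall>n\<ge>N. norm (ev (\<sigma> m) x - ev (\<sigma> n) x) < \<epsilon>"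
      using ev_le[OF x] by (meson le_less_trans)
  qed
  then have "\<forall>x. \<exists>l. x \<in> X \<longrightarrow> (\<lambda>n. ev (\<sigma> n) x) \<longlonglongrightarrow> l" by (auto simp: convergent_def)
  then obtain g where g: "\<And>x. x \<in> X \<Longrightarrow> (\<lambda>n. ev (\<sigma> n) x) \<longlonglongrightarrow> g x" by metis
  obtain N where N: "\<And>n. N \<le> n \<Longrightarrow> vdist V (\<sigma> n) (\<sigma> N) < 1"
    using cau[of 1] by auto
  have "vnorm V (\<sigma> n) \<le> vnorm V (\<sigma> N) + 1" if n: "N \<le> n" for n
  proof (rule norm_leI[OF mem])
    fix x assume x: "x \<in> X"
    have "norm (ev (\<sigma> n) x) \<le> norm (ev (\<sigma> N) x) + norm (ev (\<sigma> n) x - ev (\<sigma> N) x)"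
      by (rule norm_triangle_sub)
    with ev_le[OF x, of n N] N[OF n] ev_le_norm[OF mem x, of N]
    show "norm (ev (\<sigma> n) x) \<le> vnorm V (\<sigma> N) + 1" by linarith
  qed
  from lim[OF mem this g] obtain f where f: "f \<in> vcarrier V" "\<And>x. x \<in> X \<Longrightarrow> ev f x = g x" by blast
  have "limitin mtopology \<sigma> f sequentially"
    unfolding limit_metric_sequentially
  proof (intro conjI allI impI f)
    fix \<epsilon> :: real assume \<epsilon>: "0 < \<epsilon>"
    then obtain N where N: "\<And>n n'. N \<le> n \<Longrightarrow> N \<le> n' \<Longrightarrow> vdist V (\<sigma> n) (\<sigma> n') < \<epsilon> / 2"
      using cau[OF half_gt_zero] by blast
    have "vdist V (\<sigma> n) f < \<epsilon>" if n: "N \<le> n" for n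
    proof -
      have "norm (ev (vdiff V (\<sigma> n) f) x) \<le> \<epsilon> / 2" if x: "x \<in> X" for x
      proof (rule tendsto_upperbound)
        show "(\<lambda>n'. norm (ev (\<sigma> n) x - ev (\<sigma> n') x)) \<longlonglongrightarrow> norm (ev (vdiff V (\<sigma> n) f) x)"
          unfolding ev_diff[OF mem f(1) x] f(2)[OF x] by (intro tendsto_intros g x)
        show "\<forall>\<^sub>F n' in sequentially. norm (ev (\<sigma> n) x - ev (\<sigma> n') x) \<le> \<epsilon> / 2"
          by (rule eventually_sequentiallyI[of N]) (rule order_trans[OF ev_le[OF x] less_imp_le[OF N[OF n]]])
      qed simp
      then have "vdist V (\<sigma> n) f \<le> \<epsilon> / 2"
        using norm_leI[OF diff_closed[OF mem f(1)]] by (simp add: vdist_def mem f(1) del: le_divide_eq_numeral1)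
      with \<epsilon> show ?thesis by simp
    qed
    then show "\<exists>N. \<forall>n\<ge>N. \<sigma> n \<in> vcarrier V \<and> vdist V (\<sigma> n) f < \<epsilon>" using mem by blast
  qed
  then show "\<exists>x. limitin mtopology \<sigma> x sequentially" ..
qed

text \<open>The algebraic axioms are inherited from the scalar field through \<open>ev\<close>.\<close>
lemma banach_spaceI:
  assumes "mcomplete"
  shows "banach_space V"
proof
  show "\<exists>y\<in>vcarrier V. vadd V x y = vzero V" if "x \<in> vcarrier V" for x
  proof (rule bexI)
    show "vadd V x (vscale V (-1) x) = vzero V"
      by (rule ev_inj) (simp_all add: that add_mem scale_mem zero_mem ev_add ev_scale ev_zero)
  qed (rule scale_mem[OF that])
  show "vnorm V x = 0 \<longleftrightarrow> x = vzero V" if x: "x \<in> vcarrier V" for x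
  proof
    assume "vnorm V x = 0"
    then show "x = vzero V" using ev_le_norm[OF x] by (auto intro!: ev_inj simp: x zero_mem ev_zero)
  next
    assume "x = vzero V"
    then have "vnorm V x \<le> 0" by (auto intro!: norm_leI simp: ev_zero zero_mem)
    then show "vnorm V x = 0" using vnorm_nonneg[OF x] by simp
  qed
qed ((simp add: add_mem scale_mem zero_mem vnorm_nonneg vnorm_triangle vnorm_scale assms; fail)
    | (rule ev_inj, simp_all add: add_mem scale_mem zero_mem ev_add ev_scale ev_zero algebra_simps; fail))+

end

section \<open>Dual spaces and bounded derivations\<close>

lemma (in banach_space) functional_zero:
  assumes "f \<in> bounded_functionals V"
  shows "f (vzero V) = 0"
proof -
  have "f (vadd V (vzero V) (vzero V)) = f (vzero V) + f (vzero V)"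
    using assms zero_closed by (simp add: bounded_functionals_def)
  then show ?thesis by (simp add: add_zero zero_closed)
qed

lemma (in banach_space) functional_le_of_unit_ball:
  assumes f: "f \<in> bounded_functionals V" and z: "z \<in> vcarrier V"
    and le: "\<And>y. y \<in> vcarrier V \<Longrightarrow> vnorm V y \<le> 1 \<Longrightarrow> norm (f y) \<le> K"
  shows "norm (f z) \<le> K * vnorm V z"
proof (cases "vnorm V z = 0")
  case True
  then show ?thesis using functional_zero[OF f] norm_eq_zero[OF z] by simp
next
  case False
  then have pos: "0 < vnorm V z" using norm_nonneg[OF z] by simp
  let ?c = "of_real (inverse (vnorm V z)) :: 'k"
  have r: "\<bar>inverse (vnorm V z)\<bar> = inverse (vnorm V z)" using pos by simp
  have c: "norm ?c = inverse (vnorm V z)" by (simp only: norm_of_real r)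
  have "vnorm V (vscale V ?c z) = 1" using pos by (simp only: norm_vscale[OF z] c) simp
  then have "norm (f (vscale V ?c z)) \<le> K"
    by (intro le scale_closed z) simp
  moreover have "f (vscale V ?c z) = ?c * f z"
    using f z by (simp add: bounded_functionals_def)
  ultimately have "inverse (vnorm V z) * norm (f z) \<le> K" by (simp only: norm_mult c)
  then show ?thesis using pos by (simp add: field_simps)
qed

lemma (in banach_space) functional_bdd_unit_ball:
  assumes "f \<in> bounded_functionals V"
  shows "bdd_above ((\<lambda>z. norm (f z)) ` {z \<in> vcarrier V. vnorm V z \<le> 1})"
proof -
  obtain K where K: "\<And>x. x \<in> vcarrier V \<Longrightarrow> norm (f x) \<le> K * vnorm V x"
    using assms unfolding bounded_functionals_def by blast
  have "norm (f z) \<le> \<bar>K\<bar>" if "z \<in> vcarrier V" "vnorm V z \<le> 1" for z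
  proof -
    have "K * vnorm V z \<le> \<bar>K\<bar> * 1"
      using that norm_nonneg[of z] by (intro mult_mono) auto
    then show ?thesis using K[OF that(1)] by linarith
  qed
  then show ?thesis by (auto intro!: bdd_aboveI)
qed

lemma evaluation_space_dual:
  fixes Z :: "('k::{real_normed_field,heine_borel}, 'a, 'z) bimod"
  assumes "banach_space Z"
  shows "evaluation_space (dual_bimodule Z) (\<lambda>f. f) {z \<in> vcarrier Z. vnorm Z z \<le> 1}"
proof -
  interpret Z: banach_space Z by (rule assms)
  have bf: "(\<lambda>z\<in>vcarrier Z. g z) \<in> bounded_functionals Z"
    if "\<And>x y. x \<in> vcarrier Z \<Longrightarrow> y \<in> vcarrier Z \<Longrightarrow> g (vadd Z x y) = g x + g y"
      "\<And>c x. x \<in> vcarrier Z \<Longrightarrow> g (vscale Z c x) = c * g x"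
      "\<And>x. x \<in> vcarrier Z \<Longrightarrow> norm (g x) \<le> K * vnorm Z x" for g :: "'z \<Rightarrow> 'k" and K
    using that by (auto simp: bounded_functionals_def Z.add_closed Z.scale_closed intro!: exI[of _ K])
  show ?thesis
  proof
    show "{z \<in> vcarrier Z. vnorm Z z \<le> 1} \<noteq> {}"
      using Z.zero_closed Z.norm_eq_zero[OF Z.zero_closed] by force
    show "vzero (dual_bimodule Z) \<in> vcarrier (dual_bimodule Z)"
      unfolding dual_bimodule_def by simp (rule bf[of _ 0], auto)
  next
    fix f g assume fg: "f \<in> vcarrier (dual_bimodule Z)" "g \<in> vcarrier (dual_bimodule Z)"
    then have f: "f \<in> bounded_functionals Z" and g: "g \<in> bounded_functionals Z"
      by (simp_all add: dual_bimodule_def)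
    obtain K L where K: "\<And>x. x \<in> vcarrier Z \<Longrightarrow> norm (f x) \<le> K * vnorm Z x"
      and L: "\<And>x. x \<in> vcarrier Z \<Longrightarrow> norm (g x) \<le> L * vnorm Z x"
      using f g unfolding bounded_functionals_def by blast
    have "(\<lambda>z\<in>vcarrier Z. f z + g z) \<in> bounded_functionals Z"
    proof (rule bf)
      show "norm (f x + g x) \<le> (K + L) * vnorm Z x" if "x \<in> vcarrier Z" for x
        using K[OF that] L[OF that] norm_triangle_ineq[of "f x" "g x"] by (simp add: distrib_right)
    qed (use f g in \<open>auto simp: bounded_functionals_def algebra_simps\<close>)
    then show "vadd (dual_bimodule Z) f g \<in> vcarrier (dual_bimodule Z)"
      by (simp add: dual_bimodule_def)
    show "vscale (dual_bimodule Z) c f \<in> vcarrier (dual_bimodule Z)" for c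
    proof -
      have "(\<lambda>z\<in>vcarrier Z. c * f z) \<in> bounded_functionals Z"
      proof (rule bf)
        show "norm (c * f x) \<le> (norm c * K) * vnorm Z x" if "x \<in> vcarrier Z" for x
          using K[OF that] by (simp add: norm_mult mult.assoc mult_left_mono)
      qed (use f in \<open>auto simp: bounded_functionals_def algebra_simps\<close>)
      then show ?thesis by (simp add: dual_bimodule_def)
    qed
    show "bdd_above ((\<lambda>x. norm (f x)) ` {z \<in> vcarrier Z. vnorm Z z \<le> 1})"
      by (rule Z.functional_bdd_unit_ball[OF f])
    assume eq: "\<And>z. z \<in> {z \<in> vcarrier Z. vnorm Z z \<le> 1} \<Longrightarrow> f z = g z"
    have h: "(\<lambda>z\<in>vcarrier Z. f z - g z) \<in> bounded_functionals Z"
    proof (rule bf)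
      show "norm (f x - g x) \<le> (K + L) * vnorm Z x" if "x \<in> vcarrier Z" for x
        using K[OF that] L[OF that] norm_triangle_ineq4[of "f x" "g x"] by (simp add: distrib_right)
    qed (use f g in \<open>auto simp: bounded_functionals_def algebra_simps\<close>)
    have "f z = g z" if z: "z \<in> vcarrier Z" for z
      using Z.functional_le_of_unit_ball[OF h z, of 0] eq z by simp
    then show "f = g"
      using f g unfolding bounded_functionals_def by (intro extensionalityI[of f "vcarrier Z"]) auto
  qed (auto simp: dual_bimodule_def)
qed

text \<open>Continuity for the dual norm, in terms of the pairing only. In this form it can be read off from,
  and verified for, concrete derivations without mentioning the supremum norm.\<close>
lemma continuous_into_dual_iff:
  fixes Z :: "('k::{real_normed_field,heine_borel}, 'a, 'z) bimod"
    and D :: "'b::metric_space \<Rightarrow> 'z \<Rightarrow> 'k"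
  assumes Z: "banach_space Z" and D: "\<And>a. a \<in> S \<Longrightarrow> D a \<in> bounded_functionals Z"
  shows "continuous_map (top_of_set S)
      (Metric_space.mtopology (vcarrier (dual_bimodule Z)) (vdist (dual_bimodule Z))) D \<longleftrightarrow>
    (\<forall>a\<in>S. \<forall>\<epsilon>>0. \<exists>\<delta>>0. \<forall>b\<in>S. dist b a < \<delta> \<longrightarrow>
      (\<forall>z\<in>vcarrier Z. norm (D b z - D a z) \<le> \<epsilon> * vnorm Z z))" (is "?L \<longleftrightarrow> ?R")
proof -
  interpret Z: banach_space Z by (rule Z)
  interpret W: evaluation_space "dual_bimodule Z" "\<lambda>f. f" "{z \<in> vcarrier Z. vnorm Z z \<le> 1}"
    by (rule evaluation_space_dual[OF Z])
  have mem: "D a \<in> vcarrier (dual_bimodule Z)" if "a \<in> S" for a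
    using D[OF that] by (simp add: dual_bimodule_def)
  have ev: "vdiff (dual_bimodule Z) (D a) (D b) z = D a z - D b z" if "z \<in> vcarrier Z" for a b z
    using that by (simp add: vdiff_def dual_bimodule_def)
  have le: "norm (D b z - D a z) \<le> vdist (dual_bimodule Z) (D a) (D b) * vnorm Z z"
    if a: "a \<in> S" and b: "b \<in> S" and z: "z \<in> vcarrier Z" for a b z
  proof -
    have "vdiff (dual_bimodule Z) (D b) (D a) \<in> bounded_functionals Z"
      using W.diff_closed[OF mem[OF b] mem[OF a]] by (simp add: dual_bimodule_def)
    from Z.functional_le_of_unit_ball[OF this z, of "vdist (dual_bimodule Z) (D b) (D a)"]
      W.ev_le_norm[OF W.diff_closed[OF mem[OF b] mem[OF a]]]
    show ?thesis using z by (simp add: ev W.commute[of "D a"]) (simp add: vdist_def mem a b)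
  qed
  have ge: "vdist (dual_bimodule Z) (D a) (D b) \<le> \<epsilon>"
    if a: "a \<in> S" and b: "b \<in> S" and "0 < \<epsilon>"
      and le: "\<And>z. z \<in> vcarrier Z \<Longrightarrow> norm (D b z - D a z) \<le> \<epsilon> * vnorm Z z" for a b \<epsilon>
  proof -
    have "vnorm (dual_bimodule Z) (vdiff (dual_bimodule Z) (D a) (D b)) \<le> \<epsilon>"
    proof (rule W.norm_leI[OF W.diff_closed[OF mem[OF a] mem[OF b]]])
      fix z assume "z \<in> {z \<in> vcarrier Z. vnorm Z z \<le> 1}"
      then have z: "z \<in> vcarrier Z" "vnorm Z z \<le> 1" by auto
      have "\<epsilon> * vnorm Z z \<le> \<epsilon>"
        using z(2) \<open>0 < \<epsilon>\<close> by (simp add: mult_le_cancel_left1)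
      with le[OF z(1)] show "norm (vdiff (dual_bimodule Z) (D a) (D b) z) \<le> \<epsilon>"
        by (simp add: ev[OF z(1)] norm_minus_commute)
    qed
    then show ?thesis by (simp add: vdist_def mem a b)
  qed
  show ?thesis
  proof
    assume L: ?L
    show ?R
    proof (intro ballI allI impI)
      fix a and \<epsilon> :: real assume a: "a \<in> S" and \<epsilon>: "0 < \<epsilon>"
      have "\<exists>T. openin (top_of_set S) T \<and> a \<in> T \<and> (\<forall>y\<in>T. D y \<in> W.mball (D a) \<epsilon>)"
        using L a \<epsilon> unfolding W.continuous_map_to_metric by simp
      then obtain T where T: "openin (top_of_set S) T" "a \<in> T"
        and ball: "\<And>y. y \<in> T \<Longrightarrow> D y \<in> W.mball (D a) \<epsilon>"
        by blast
      then obtain \<delta> where \<delta>: "\<delta> > 0" "\<And>y. y \<in> S \<Longrightarrow> dist y a < \<delta> \<Longrightarrow> y \<in> T"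
        unfolding openin_euclidean_subtopology_iff by blast
      have "norm (D b z - D a z) \<le> \<epsilon> * vnorm Z z"
        if "b \<in> S" "dist b a < \<delta>" "z \<in> vcarrier Z" for b z
      proof -
        have "vdist (dual_bimodule Z) (D a) (D b) < \<epsilon>" using ball[OF \<delta>(2)] that by auto
        then have "vdist (dual_bimodule Z) (D a) (D b) * vnorm Z z \<le> \<epsilon> * vnorm Z z"
          using that(3) by (intro mult_right_mono Z.norm_nonneg) auto
        with le[OF a that(1,3)] show ?thesis by linarith
      qed
      with \<delta>(1) show "\<exists>\<delta>>0. \<forall>b\<in>S. dist b a < \<delta> \<longrightarrow>
          (\<forall>z\<in>vcarrier Z. norm (D b z - D a z) \<le> \<epsilon> * vnorm Z z)" by blast
    qed
  next
    assume R: ?R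
    show ?L unfolding W.continuous_map_to_metric
    proof (intro ballI allI impI)
      fix a and \<epsilon> :: real assume "a \<in> topspace (top_of_set S)" and \<epsilon>: "0 < \<epsilon>"
      then have a: "a \<in> S" by simp
      obtain \<delta> where \<delta>: "\<delta> > 0" "\<And>b z. b \<in> S \<Longrightarrow> dist b a < \<delta> \<Longrightarrow> z \<in> vcarrier Z \<Longrightarrow>
          norm (D b z - D a z) \<le> \<epsilon> / 2 * vnorm Z z"
        using R a half_gt_zero[OF \<epsilon>] by metis
      have "D b \<in> W.mball (D a) \<epsilon>" if "b \<in> S \<inter> ball a \<delta>" for b
        using ge[OF a _ half_gt_zero[OF \<epsilon>] \<delta>(2), of b] that a \<epsilon> by (auto simp: mem dist_commute)
      then show "\<exists>T. openin (top_of_set S) T \<and> a \<in> T \<and> (\<forall>y\<in>T. D y \<in> W.mball (D a) \<epsilon>)"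
        using a \<delta>(1) by (intro exI[of _ "S \<inter> ball a \<delta>"]) (auto simp: openin_open_Int)
    qed
  qed
qed

lemma (in banach_algebra) continuous_derivation_bounded:
  fixes Z :: "('k, 'a, 'z) bimod"
  assumes Z: "banach_space Z" and S: "subspace S"
    and D: "continuous_derivation scl S (dual_bimodule Z) D"
  shows "\<exists>K\<ge>0. \<forall>a\<in>S. \<forall>z\<in>vcarrier Z. norm (D a z) \<le> K * norm a * vnorm Z z"
proof -
  interpret Z: banach_space Z by (rule Z)
  have 0: "0 \<in> S" using S by (rule subspace_0)
  have sc: "D (scl c a) z = c * D a z" if "a \<in> S" "z \<in> vcarrier Z" for c a z
    using D that by (auto simp: continuous_derivation_def dual_bimodule_def)
  have D0: "D 0 z = 0" if "z \<in> vcarrier Z" for z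
    using sc[OF 0 that, of 0] by simp
  have mem: "\<And>a. a \<in> S \<Longrightarrow> D a \<in> bounded_functionals Z"
    using D by (auto simp: continuous_derivation_def dual_bimodule_def)
  have "\<forall>a\<in>S. \<forall>\<epsilon>>0. \<exists>\<delta>>0. \<forall>b\<in>S. dist b a < \<delta> \<longrightarrow>
      (\<forall>z\<in>vcarrier Z. norm (D b z - D a z) \<le> \<epsilon> * vnorm Z z)"
    by (rule iffD1[OF continuous_into_dual_iff[OF Z mem]])
      (use D in \<open>auto simp: continuous_derivation_def\<close>)
  from bspec[OF this 0]
  have "\<exists>\<delta>>0. \<forall>b\<in>S. dist b 0 < \<delta> \<longrightarrow> (\<forall>z\<in>vcarrier Z. norm (D b z - D 0 z) \<le> 1 * vnorm Z z)"
    using zero_less_one by blast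
  then obtain \<delta> where \<delta>: "\<delta> > 0" and le: "\<And>b z. b \<in> S \<Longrightarrow> norm b < \<delta> \<Longrightarrow> z \<in> vcarrier Z \<Longrightarrow>
      norm (D b z) \<le> vnorm Z z"
    by (auto simp: D0)
  have "norm (D a z) \<le> 2 / \<delta> * norm a * vnorm Z z" if a: "a \<in> S" and z: "z \<in> vcarrier Z" for a z
  proof (cases "a = 0")
    case True
    then show ?thesis by (simp add: D0 z)
  next
    case False
    let ?c = "of_real (\<delta> / (2 * norm a)) :: 'k"
    have c: "norm ?c = \<delta> / (2 * norm a)" using \<delta> by (simp only: norm_of_real) simp
    have "norm (scl ?c a) < \<delta>" using False \<delta> by (simp only: norm_scale c) (simp add: field_simps)
    then have "norm (D (scl ?c a) z) \<le> vnorm Z z"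
      using subspace_scale[OF S a] z by (intro le)
    then have "\<delta> / (2 * norm a) * norm (D a z) \<le> vnorm Z z"
      by (simp only: sc[OF a z] norm_mult c)
    then show ?thesis using False \<delta> by (simp add: field_simps)
  qed
  moreover have "0 \<le> 2 / \<delta>" using \<delta> by simp
  ultimately show ?thesis by blast
qed

section \<open>Bilinear forms on the unitization\<close>

context banach_algebra
begin

\<comment> \<open>Elements of the unitization are pairs, but statements about them are kept free of coordinates.\<close>
declare split_paired_All [simp del] split_paired_Ex [simp del]

text \<open>The unitization \<open>A\<^sup>#\<close> is \<open>'a \<times> 'k\<close>, with \<open>(a, \<lambda>)\<close> standing for \<open>a + \<lambda>1\<close>. It acts on \<open>A\<close> from the
  left, and on every left ideal.\<close>
definition uact :: "'a \<times> 'k \<Rightarrow> 'a \<Rightarrow> 'a" where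
  "uact p x = fst p * x + scl (snd p) x"

text \<open>This is the product \<open>(a + \<lambda>1) (b + \<mu>1)\<close>; the element \<open>1\<close> is \<open>(0, 1)\<close>.\<close>
definition umult :: "'a \<times> 'k \<Rightarrow> 'a \<times> 'k \<Rightarrow> 'a \<times> 'k" where
  "umult p q = (uact p (fst q) + scl (snd q) (fst p), snd p * snd q)"

definition uscale :: "'k \<Rightarrow> 'a \<times> 'k \<Rightarrow> 'a \<times> 'k" where
  "uscale c p = (scl c (fst p), c * snd p)"

lemmas scl_simps = scale_right_distrib scale_left_distrib mult_scale_left mult_scale_right
  scale_zero_left scale_zero_right scale_right_diff_distrib scale_left_diff_distrib

lemma uact_add_left: "uact (p + p') x = uact p x + uact p' x"
  and uact_add_right: "uact p (x + y) = uact p x + uact p y"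
  and uact_diff_right: "uact p (x - y) = uact p x - uact p y"
  and uact_scale_left: "uact (uscale c p) x = scl c (uact p x)"
  and uact_scale_right: "uact p (scl c x) = scl c (uact p x)"
  and uact_umult: "uact (umult p q) x = uact p (uact q x)"
  and uact_times: "uact p x * y = uact p (x * y)"
  and uact_one: "uact (0, 1) x = x"
  and uact_embed: "uact (a, 0) x = a * x"
  by (simp_all add: uact_def umult_def uscale_def scl_simps algebra_simps)

lemma umult_add_left: "umult (p + p') q = umult p q + umult p' q"
  and umult_add_right: "umult p (q + q') = umult p q + umult p q'"
  and umult_scale_left: "umult (uscale c p) q = uscale c (umult p q)"
  and umult_scale_right: "umult p (uscale c q) = uscale c (umult p q)"
  and umult_assoc: "umult (umult p q) r = umult p (umult q r)"
  and umult_one_left: "umult (0, 1) p = p"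
  and umult_one_right: "umult p (0, 1) = p"
  and umult_embed: "umult (a, 0) (b, 0) = (a * b, 0)"
  by (simp_all add: uact_def umult_def uscale_def scl_simps algebra_simps prod_eq_iff)

lemma uscale_of_real: "uscale (of_real r) p = r *\<^sub>R p"
  by (simp add: uscale_def scale_of_real prod_eq_iff scaleR_conv_of_real)

lemma uscale_embed: "uscale c (x, 0) = (scl c x, 0)"
  by (simp add: uscale_def)

lemma norm_fst_le_norm: "norm (fst p) \<le> norm p" and norm_snd_le_norm: "norm (snd p) \<le> norm p"
  for p :: "'a \<times> 'k"
  using norm_fst_le[of "fst p" "snd p"] norm_snd_le[of "snd p" "fst p"] by simp_all

lemma norm_uact_le: "norm (uact p x) \<le> 2 * norm p * norm x"
proof -
  have "norm (uact p x) \<le> norm (fst p) * norm x + norm (snd p) * norm x"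
    unfolding uact_def by (rule norm_triangle_le) (simp add: norm_scale add_mono norm_mult_ineq)
  also have "\<dots> \<le> norm p * norm x + norm p * norm x"
    by (intro add_mono mult_right_mono norm_fst_le_norm norm_snd_le_norm) auto
  finally show ?thesis by (simp add: mult_ac)
qed

lemma norm_umult_le: "norm (umult p q) \<le> 4 * norm p * norm q"
proof -
  have 1: "norm (uact p (fst q)) \<le> 2 * norm p * norm q"
    by (rule order_trans[OF norm_uact_le]) (intro mult_left_mono norm_fst_le_norm, simp)
  have 2: "norm (scl (snd q) (fst p)) \<le> norm q * norm p"
    unfolding norm_scale by (intro mult_mono norm_fst_le_norm norm_snd_le_norm) auto
  have 3: "norm (snd p * snd q) \<le> norm p * norm q"
    unfolding norm_mult by (intro mult_mono norm_snd_le_norm) auto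
  have "norm (umult p q) \<le> norm (uact p (fst q) + scl (snd q) (fst p)) + norm (snd p * snd q)"
    unfolding umult_def by (rule norm_Pair_le)
  also have "\<dots> \<le> (2 * norm p * norm q + norm q * norm p) + norm p * norm q"
    by (intro add_mono norm_triangle_le 1 2 3)
  finally show ?thesis by (simp add: algebra_simps)
qed

definition form_bound :: "('a \<times> 'k \<Rightarrow> 'a \<times> 'k \<Rightarrow> 'k) \<Rightarrow> real \<Rightarrow> bool" where
  "form_bound \<phi> K \<longleftrightarrow> (\<forall>p q. norm (\<phi> p q) \<le> K * norm p * norm q)"

definition forms :: "('a \<times> 'k \<Rightarrow> 'a \<times> 'k \<Rightarrow> 'k) set" where
  "forms = {\<phi>. (\<forall>p p' q. \<phi> (p + p') q = \<phi> p q + \<phi> p' q) \<and>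
    (\<forall>p q q'. \<phi> p (q + q') = \<phi> p q + \<phi> p q') \<and>
    (\<forall>c p q. \<phi> (uscale c p) q = c * \<phi> p q) \<and> (\<forall>c p q. \<phi> p (uscale c q) = c * \<phi> p q) \<and>
    (\<exists>K. form_bound \<phi> K)}"

lemma formsI:
  assumes "\<And>p p' q. \<phi> (p + p') q = \<phi> p q + \<phi> p' q" "\<And>p q q'. \<phi> p (q + q') = \<phi> p q + \<phi> p q'"
    "\<And>c p q. \<phi> (uscale c p) q = c * \<phi> p q" "\<And>c p q. \<phi> p (uscale c q) = c * \<phi> p q"
    "form_bound \<phi> K"
  shows "\<phi> \<in> forms"
  using assms unfolding forms_def by blast

lemma
  assumes "\<phi> \<in> forms"
  shows form_add_left: "\<phi> (p + p') q = \<phi> p q + \<phi> p' q"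
    and form_add_right: "\<phi> p (q + q') = \<phi> p q + \<phi> p q'"
    and form_scale_left: "\<phi> (uscale c p) q = c * \<phi> p q"
    and form_scale_right: "\<phi> p (uscale c q) = c * \<phi> p q"
    and form_bounded: "\<exists>K\<ge>0. form_bound \<phi> K"
proof -
  obtain K where "form_bound \<phi> K" using assms by (auto simp: forms_def)
  then have "form_bound \<phi> \<bar>K\<bar>"
    unfolding form_bound_def by (meson abs_ge_self mult_right_mono norm_ge_zero order_trans)
  then show "\<exists>K\<ge>0. form_bound \<phi> K" by (intro exI[of _ "\<bar>K\<bar>"]) simp
qed (use assms in \<open>auto simp: forms_def\<close>)

lemmas form_simps = form_add_left form_add_right form_scale_left form_scale_right

lemma form_bound_add: "form_bound \<phi> K \<Longrightarrow> form_bound \<psi> L \<Longrightarrow> form_bound (\<lambda>p q. \<phi> p q + \<psi> p q) (K + L)"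
  unfolding form_bound_def distrib_right by (intro allI norm_triangle_le add_mono) auto

lemma form_bound_scale: "form_bound \<phi> K \<Longrightarrow> form_bound (\<lambda>p q. c * \<phi> p q) (norm c * K)"
  unfolding form_bound_def norm_mult mult.assoc by (auto intro!: mult_left_mono)

lemma form_bound_translate:
  assumes "form_bound \<phi> K" "0 \<le> K"
  shows "form_bound (\<lambda>p q. \<phi> (umult r p) q) (K * 4 * norm r)"
    and "form_bound (\<lambda>p q. \<phi> p (umult q r)) (K * 4 * norm r)"
    and "form_bound (\<lambda>p q. \<phi> (umult p q) r) (K * 4 * norm r)"
proof -
  have *: "norm (\<phi> p q) \<le> K * norm p * norm q" for p q using assms(1) by (simp add: form_bound_def)
  have **: "norm (\<phi> p q) \<le> K * a * b" if "norm p \<le> a" "norm q \<le> b" for p q a b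
    using *[of p q] that assms(2)
    by (meson order_trans mult_mono mult_left_mono norm_ge_zero mult_nonneg_nonneg)
  show "form_bound (\<lambda>p q. \<phi> (umult r p) q) (K * 4 * norm r)"
    unfolding form_bound_def
    by (intro allI order_trans[OF **[OF norm_umult_le order_refl]]) (simp add: mult_ac)
  show "form_bound (\<lambda>p q. \<phi> p (umult q r)) (K * 4 * norm r)"
    unfolding form_bound_def
    by (intro allI order_trans[OF **[OF order_refl norm_umult_le]]) (simp add: mult_ac)
  show "form_bound (\<lambda>p q. \<phi> (umult p q) r) (K * 4 * norm r)"
    unfolding form_bound_def
    by (intro allI order_trans[OF **[OF norm_umult_le order_refl]]) (simp add: mult_ac)
qed

lemma forms_add:
  assumes "\<phi> \<in> forms" "\<psi> \<in> forms"
  shows "(\<lambda>p q. \<phi> p q + \<psi> p q) \<in> forms"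
proof -
  obtain K L where "form_bound \<phi> K" "form_bound \<psi> L"
    using form_bounded assms by blast
  from form_bound_add[OF this] show ?thesis
    by (rule formsI[rotated -1]) (simp_all add: form_simps assms algebra_simps)
qed

lemma forms_scale:
  assumes "\<phi> \<in> forms"
  shows "(\<lambda>p q. c * \<phi> p q) \<in> forms"
proof -
  obtain K where "form_bound \<phi> K"
    using form_bounded assms by blast
  from form_bound_scale[OF this] show ?thesis
    by (rule formsI[rotated -1]) (simp_all add: form_simps assms algebra_simps)
qed

lemma forms_diff: "\<phi> \<in> forms \<Longrightarrow> \<psi> \<in> forms \<Longrightarrow> (\<lambda>p q. \<phi> p q - \<psi> p q) \<in> forms"
  using forms_add[OF _ forms_scale[of \<psi> "-1"], of \<phi>] by simp

lemma forms_zero: "(\<lambda>p q. 0) \<in> forms"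
  by (rule formsI[of _ 0]) (auto simp: form_bound_def)

lemma forms_translate:
  assumes "\<phi> \<in> forms"
  shows "(\<lambda>p q. \<phi> (umult r p) q) \<in> forms" "(\<lambda>p q. \<phi> p (umult q r)) \<in> forms"
    "(\<lambda>p q. \<phi> (umult p q) r) \<in> forms"
proof -
  obtain K where K: "0 \<le> K" "form_bound \<phi> K" using form_bounded[OF assms] by blast
  note umult_simps = umult_add_left umult_add_right umult_scale_left umult_scale_right
  show "(\<lambda>p q. \<phi> (umult r p) q) \<in> forms"
    by (rule formsI[OF _ _ _ _ form_bound_translate(1)[OF K(2,1)]]) (simp_all add: umult_simps form_simps[OF assms])
  show "(\<lambda>p q. \<phi> p (umult q r)) \<in> forms"
    by (rule formsI[OF _ _ _ _ form_bound_translate(2)[OF K(2,1)]]) (simp_all add: umult_simps form_simps[OF assms])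
  show "(\<lambda>p q. \<phi> (umult p q) r) \<in> forms"
    by (rule formsI[OF _ _ _ _ form_bound_translate(3)[OF K(2,1)]]) (simp_all add: umult_simps form_simps[OF assms])
qed

text \<open>A form is determined by its values on unit vectors. Only real scalars are used here, because the
  pair type is a normed space over the reals.\<close>
lemma form_sgn:
  assumes "\<phi> \<in> forms"
  shows "\<phi> p q = of_real (norm p) * (of_real (norm q) * \<phi> (sgn p) (sgn q))"
proof -
  have *: "r = uscale (of_real (norm r)) (sgn r)" for r :: "'a \<times> 'k"
    unfolding uscale_of_real by (cases "r = 0") (simp_all add: sgn_div_norm)
  show ?thesis by (subst *[of p], subst *[of q]) (simp only: form_simps[OF assms] mult.left_commute)
qed

lemma form_bound_unit_ball:
  assumes "\<phi> \<in> forms" and le: "\<And>p q. norm p \<le> 1 \<Longrightarrow> norm q \<le> 1 \<Longrightarrow> norm (\<phi> p q) \<le> K"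
  shows "form_bound \<phi> K"
  unfolding form_bound_def
proof (intro allI)
  fix p q
  have "norm (\<phi> p q) = norm p * (norm q * norm (\<phi> (sgn p) (sgn q)))"
    by (subst form_sgn[OF assms(1)]) (simp add: norm_mult)
  also have "\<dots> \<le> norm p * (norm q * K)"
    by (intro mult_left_mono le) (auto simp: norm_sgn)
  finally show "norm (\<phi> p q) \<le> K * norm p * norm q" by (simp add: mult_ac)
qed

section \<open>The bimodule of forms and the universal derivation\<close>

text \<open>The kernel of \<open>A\<^sup># \<otimes> A\<^sup># \<rightarrow> A\<^sup>#\<close> is spanned by the elements \<open>p \<otimes> q - p q \<otimes> 1\<close>, so a functional on
  it is a form \<open>\<phi>\<close> with \<open>\<phi> p 1 = 0\<close>. The actions are the duals of the left and right multiplication,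
  and multiplying \<open>p \<otimes> q - p q \<otimes> 1\<close> on the right by \<open>c\<close> gives
  \<open>(p \<otimes> q c - p q c \<otimes> 1) - (p q \<otimes> c - p q c \<otimes> 1)\<close>: this is where the second term of the left
  action comes from.\<close>
definition form_bimodule :: "('k, 'a, 'a \<times> 'k \<Rightarrow> 'a \<times> 'k \<Rightarrow> 'k) bimod" where
  "form_bimodule =
    \<lparr>vcarrier = {\<phi> \<in> forms. \<forall>p. \<phi> p (0, 1) = 0},
     vadd = (\<lambda>\<phi> \<psi> p q. \<phi> p q + \<psi> p q),
     vzero = (\<lambda>p q. 0),
     vscale = (\<lambda>c \<phi> p q. c * \<phi> p q),
     vnorm = (\<lambda>\<phi>. SUP x\<in>cball 0 1 \<times> cball 0 1. norm (\<phi> (fst x) (snd x))),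
     lact = (\<lambda>c \<phi> p q. \<phi> p (umult q (c, 0)) - \<phi> (umult p q) (c, 0)),
     ract = (\<lambda>\<phi> c p q. \<phi> (umult (c, 0) p) q)\<rparr>"

lemma form_bimodule_simps:
  "\<phi> \<in> vcarrier form_bimodule \<longleftrightarrow> \<phi> \<in> forms \<and> (\<forall>p. \<phi> p (0, 1) = 0)"
  "vadd form_bimodule \<phi> \<psi> = (\<lambda>p q. \<phi> p q + \<psi> p q)"
  "vzero form_bimodule = (\<lambda>p q. 0)"
  "vscale form_bimodule c \<phi> = (\<lambda>p q. c * \<phi> p q)"
  "lact form_bimodule a \<phi> = (\<lambda>p q. \<phi> p (umult q (a, 0)) - \<phi> (umult p q) (a, 0))"
  "ract form_bimodule \<phi> a = (\<lambda>p q. \<phi> (umult (a, 0) p) q)"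
  by (simp_all add: form_bimodule_def)

sublocale form_eval: evaluation_space form_bimodule "\<lambda>\<phi> x. \<phi> (fst x) (snd x)" "cball 0 1 \<times> cball 0 1"
proof
  fix \<phi> \<psi> assume \<phi>: "\<phi> \<in> vcarrier form_bimodule"
  then obtain K where K: "0 \<le> K" "form_bound \<phi> K" 
    using form_bounded[of \<phi>] by (auto simp: form_bimodule_simps)
  have "norm (\<phi> p q) \<le> K" if "norm p \<le> 1" "norm q \<le> 1" for p q
  proof -
    have "norm (\<phi> p q) \<le> K * norm p * norm q" using K(2) by (simp add: form_bound_def)
    also have "\<dots> \<le> K * 1 * 1" using that K(1) by (intro mult_mono) auto
    finally show ?thesis by simp
  qed
  then show "bdd_above ((\<lambda>x. norm (\<phi> (fst x) (snd x))) ` (cball 0 1 \<times> cball 0 1))"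
    by (auto intro!: bdd_aboveI[of _ K])
  assume \<psi>: "\<psi> \<in> vcarrier form_bimodule"
    and eq: "\<And>x. x \<in> cball 0 1 \<times> cball 0 1 \<Longrightarrow> \<phi> (fst x) (snd x) = \<psi> (fst x) (snd x)"
  have "\<phi> p q = \<psi> p q" for p q
    using eq[of "(sgn p, sgn q)"] \<phi> \<psi> form_sgn[of \<phi> p q] form_sgn[of \<psi> p q]
    by (simp add: form_bimodule_simps norm_sgn split: if_splits)
  then show "\<phi> = \<psi>" by blast
qed (auto simp: form_bimodule_simps forms_zero forms_add forms_scale, simp_all add: form_bimodule_def)

lemma form_norm: "\<phi> \<in> vcarrier form_bimodule \<Longrightarrow> form_bound \<phi> (vnorm form_bimodule \<phi>)"
  using form_eval.ev_le_norm[of \<phi> "(p, q)" for p q]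
  by (intro form_bound_unit_ball) (auto simp: form_bimodule_simps)

lemma form_norm_le:
  assumes "\<phi> \<in> vcarrier form_bimodule" "0 \<le> K" "form_bound \<phi> K"
  shows "vnorm form_bimodule \<phi> \<le> K"
proof (rule form_eval.norm_leI[OF assms(1)])
  fix x :: "('a \<times> 'k) \<times> ('a \<times> 'k)" assume x: "x \<in> cball 0 1 \<times> cball 0 1"
  have "norm (\<phi> (fst x) (snd x)) \<le> K * norm (fst x) * norm (snd x)"
    using assms(3) by (simp add: form_bound_def)
  also have "\<dots> \<le> K * 1 * 1" using x assms(2) by (intro mult_mono) auto
  finally show "norm (\<phi> (fst x) (snd x)) \<le> K" by simp
qed

text \<open>Bilinearity, the norm bound and the vanishing condition all survive pointwise limits. Convergence
  on the unit balls extends to all arguments by homogeneity.\<close>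
lemma banach_space_form_bimodule: "banach_space form_bimodule"
proof (rule form_eval.banach_spaceI[OF form_eval.mcompleteI])
  fix \<sigma> :: "nat \<Rightarrow> 'a \<times> 'k \<Rightarrow> 'a \<times> 'k \<Rightarrow> 'k" and g K N
  assume mem: "\<And>n. \<sigma> n \<in> vcarrier form_bimodule"
    and bd: "\<And>n. N \<le> n \<Longrightarrow> vnorm form_bimodule (\<sigma> n) \<le> K"
    and lim: "\<And>x. x \<in> cball 0 1 \<times> cball 0 1 \<Longrightarrow> (\<lambda>n. \<sigma> n (fst x) (snd x)) \<longlonglongrightarrow> g x"
  have forms: "\<sigma> n \<in> forms" and van: "\<sigma> n p (0, 1) = 0" for n p
    using mem[of n] by (simp_all add: form_bimodule_simps)
  define \<phi> where "\<phi> p q = lim (\<lambda>n. \<sigma> n p q)" for p q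
  have "convergent (\<lambda>n. \<sigma> n p q)" for p q
  proof -
    have "(\<lambda>n. \<sigma> n (sgn p) (sgn q)) \<longlonglongrightarrow> g (sgn p, sgn q)"
      using lim[of "(sgn p, sgn q)"] by (simp add: norm_sgn)
    then have "(\<lambda>n. of_real (norm p) * (of_real (norm q) * \<sigma> n (sgn p) (sgn q)))
        \<longlonglongrightarrow> of_real (norm p) * (of_real (norm q) * g (sgn p, sgn q))"
      by (intro tendsto_mult tendsto_const)
    then show ?thesis unfolding form_sgn[OF forms, symmetric] by (rule convergentI)
  qed
  then have \<phi>: "(\<lambda>n. \<sigma> n p q) \<longlonglongrightarrow> \<phi> p q" for p q
    by (simp add: \<phi>_def convergent_LIMSEQ_iff)
  have "\<phi> \<in> forms"
  proof (rule formsI)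
    show "\<phi> (p + p') q = \<phi> p q + \<phi> p' q" for p p' q
      using \<phi>[of "p + p'" q] tendsto_add[OF \<phi>[of p q] \<phi>[of p' q]]
      by (simp add: form_simps[OF forms] LIMSEQ_unique)
    show "\<phi> p (q + q') = \<phi> p q + \<phi> p q'" for p q q'
      using \<phi>[of p "q + q'"] tendsto_add[OF \<phi>[of p q] \<phi>[of p q']]
      by (simp add: form_simps[OF forms] LIMSEQ_unique)
    show "\<phi> (uscale c p) q = c * \<phi> p q" for c p q
      using \<phi>[of "uscale c p" q] tendsto_mult[OF tendsto_const[of c] \<phi>[of p q]]
      by (simp add: form_simps[OF forms] LIMSEQ_unique)
    show "\<phi> p (uscale c q) = c * \<phi> p q" for c p q
      using \<phi>[of p "uscale c q"] tendsto_mult[OF tendsto_const[of c] \<phi>[of p q]]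
      by (simp add: form_simps[OF forms] LIMSEQ_unique)
    show "form_bound \<phi> K"
      unfolding form_bound_def
    proof (intro allI)
      fix p q
      have "norm (\<sigma> n p q) \<le> K * norm p * norm q" if "N \<le> n" for n
        using form_norm[OF mem[of n]] bd[OF that] unfolding form_bound_def
        by (meson mult_right_mono norm_ge_zero order_trans)
      then show "norm (\<phi> p q) \<le> K * norm p * norm q"
        by (intro tendsto_upperbound[OF tendsto_norm[OF \<phi>]] eventually_sequentiallyI[of N]) auto
    qed
  qed
  moreover have "\<phi> p (0, 1) = 0" for p
    using \<phi>[of p "(0, 1)"] by (simp add: van LIMSEQ_const_iff)
  moreover have "\<phi> (fst x) (snd x) = g x" if "x \<in> cball 0 1 \<times> cball 0 1" for x
    using \<phi> lim[OF that] LIMSEQ_unique by blast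
  ultimately show "\<exists>f\<in>vcarrier form_bimodule. \<forall>x\<in>cball 0 1 \<times> cball 0 1. f (fst x) (snd x) = g x"
    by (intro bexI[of _ \<phi>]) (simp_all add: form_bimodule_simps)
qed

lemma form_bound_diff: "form_bound \<phi> K \<Longrightarrow> form_bound \<psi> L \<Longrightarrow> form_bound (\<lambda>p q. \<phi> p q - \<psi> p q) (K + L)"
  unfolding form_bound_def distrib_right
  by (intro allI order_trans[OF norm_triangle_ineq4] add_mono) auto

lemma norm_embed: "norm ((c, 0) :: 'a \<times> 'k) = norm c"
  by (simp add: norm_Pair)

text \<open>The bimodule identities are associativity in \<open>A\<^sup>#\<close>; in the one for products under the left action the
  two terms \<open>\<phi> (p q c) d\<close> cancel.\<close>
lemma banach_bimodule_forms: "banach_bimodule scl UNIV form_bimodule"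
proof -
  interpret Z: banach_space form_bimodule by (rule banach_space_form_bimodule)
  have emb: "(a + b, 0) = (a, 0) + ((b, 0) :: 'a \<times> 'k)" "(scl c a, 0) = uscale c (a, 0)"
    "(a * b, 0) = umult (a, 0) (b, 0)" for a b c
    by (simp_all add: uscale_embed umult_embed)
  note us = umult_add_left umult_add_right umult_scale_left umult_scale_right umult_assoc
    umult_one_left umult_one_right form_simps
  have lclosed: "lact form_bimodule a \<phi> \<in> vcarrier form_bimodule"
    and rclosed: "ract form_bimodule \<phi> a \<in> vcarrier form_bimodule"
    if "\<phi> \<in> vcarrier form_bimodule" for a \<phi>
    using that by (auto simp: form_bimodule_simps forms_diff forms_translate us)
  have norms: "vnorm form_bimodule (lact form_bimodule a \<phi>) \<le> 8 * norm a * vnorm form_bimodule \<phi>"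
    "vnorm form_bimodule (ract form_bimodule \<phi> a) \<le> 4 * norm a * vnorm form_bimodule \<phi>"
    if \<phi>: "\<phi> \<in> vcarrier form_bimodule" for a \<phi>
  proof -
    note n = form_eval.vnorm_nonneg[OF \<phi>]
    note b = form_bound_translate[OF form_norm[OF \<phi>] n, of "(a, 0)", unfolded norm_embed]
    have "form_bound (lact form_bimodule a \<phi>) (8 * norm a * vnorm form_bimodule \<phi>)"
      using form_bound_diff[OF b(2,3)] by (simp add: form_bimodule_simps mult_ac)
    then show "vnorm form_bimodule (lact form_bimodule a \<phi>) \<le> 8 * norm a * vnorm form_bimodule \<phi>"
      using n by (intro form_norm_le lclosed \<phi>) auto
    have "form_bound (ract form_bimodule \<phi> a) (4 * norm a * vnorm form_bimodule \<phi>)"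
      using b(1) by (simp add: form_bimodule_simps mult_ac)
    then show "vnorm form_bimodule (ract form_bimodule \<phi> a) \<le> 4 * norm a * vnorm form_bimodule \<phi>"
      using n by (intro form_norm_le rclosed \<phi>) auto
  qed
  show ?thesis
  proof
    show "\<exists>K. \<forall>a\<in>UNIV. \<forall>z\<in>vcarrier form_bimodule.
        vnorm form_bimodule (lact form_bimodule a z) \<le> K * norm a * vnorm form_bimodule z"
      using norms by blast
    show "\<exists>K. \<forall>a\<in>UNIV. \<forall>z\<in>vcarrier form_bimodule.
        vnorm form_bimodule (ract form_bimodule z a) \<le> K * norm a * vnorm form_bimodule z"
      using norms by blast
  qed (simp_all only: lclosed rclosed, simp_all add: form_bimodule_simps emb us fun_eq_iff algebra_simps del: add_Pair)
qed

text \<open>Evaluation of forms at the element \<open>1 \<otimes> c - c \<otimes> 1\<close> of the kernel of the multiplication.\<close>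
definition universal_derivation :: "'a \<Rightarrow> ('a \<times> 'k \<Rightarrow> 'a \<times> 'k \<Rightarrow> 'k) \<Rightarrow> 'k" where
  "universal_derivation c = (\<lambda>\<phi>\<in>vcarrier form_bimodule. \<phi> (0, 1) (c, 0))"

lemma continuous_derivation_universal:
  "continuous_derivation scl UNIV (dual_bimodule form_bimodule) universal_derivation"
proof -
  interpret Z: banach_bimodule scl UNIV form_bimodule by (rule banach_bimodule_forms)
  have emb: "(a + b, 0) = (a, 0) + ((b, 0) :: 'a \<times> 'k)" "(scl c a, 0) = uscale c (a, 0)"
    "(a * b, 0) = umult (a, 0) (b, 0)" for a b c
    by (simp_all add: uscale_embed umult_embed)
  have le: "norm (\<phi> (0, 1) (c, 0)) \<le> norm c * vnorm form_bimodule \<phi>"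
    if "\<phi> \<in> vcarrier form_bimodule" for c \<phi>
  proof -
    have "norm (\<phi> (0, 1) (c, 0)) \<le> vnorm form_bimodule \<phi> * norm ((0, 1) :: 'a \<times> 'k) * norm ((c, 0) :: 'a \<times> 'k)"
      using form_norm[OF that] by (simp only: form_bound_def)
    then show ?thesis by (simp add: norm_Pair mult_ac)
  qed
  have mem: "universal_derivation c \<in> bounded_functionals form_bimodule" for c
    unfolding bounded_functionals_def universal_derivation_def
    by (auto simp: Z.add_closed Z.scale_closed le intro!: exI[of _ "norm c"])
      (simp_all add: form_bimodule_simps)
  have diff: "universal_derivation b \<phi> - universal_derivation a \<phi> = \<phi> (0, 1) (b - a, 0)"
    if "\<phi> \<in> vcarrier form_bimodule" for a b \<phi>
  proof -
    have "\<phi> (0, 1) ((b - a, 0) + (a, 0)) = \<phi> (0, 1) (b - a, 0) + \<phi> (0, 1) (a, 0)"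
      using that by (intro form_add_right) (simp add: form_bimodule_simps)
    then show ?thesis using that by (simp add: universal_derivation_def)
  qed
  have cont: "continuous_map (top_of_set UNIV) (Metric_space.mtopology
      (vcarrier (dual_bimodule form_bimodule)) (vdist (dual_bimodule form_bimodule))) universal_derivation"
    unfolding continuous_into_dual_iff[OF banach_space_form_bimodule mem]
  proof (intro ballI allI impI)
    fix a :: 'a and \<epsilon> :: real assume "0 < \<epsilon>"
    have "norm (universal_derivation b \<phi> - universal_derivation a \<phi>) \<le> \<epsilon> * vnorm form_bimodule \<phi>"
      if "dist b a < \<epsilon>" "\<phi> \<in> vcarrier form_bimodule" for b \<phi>
    proof -
      have "norm (b - a) * vnorm form_bimodule \<phi> \<le> \<epsilon> * vnorm form_bimodule \<phi>"
        using that by (intro mult_right_mono form_eval.vnorm_nonneg) (auto simp: dist_norm)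
      then show ?thesis using le[OF that(2), of "b - a"] by (simp add: diff[OF that(2)])
    qed
    with \<open>0 < \<epsilon>\<close> show "\<exists>\<delta>>0. \<forall>b\<in>UNIV. dist b a < \<delta> \<longrightarrow> (\<forall>\<phi>\<in>vcarrier form_bimodule.
        norm (universal_derivation b \<phi> - universal_derivation a \<phi>) \<le> \<epsilon> * vnorm form_bimodule \<phi>)" by blast
  qed
  show ?thesis
    unfolding continuous_derivation_def
  proof (intro conjI ballI allI)
    \<comment> \<open>Both sides are \<open>\<phi> (0, 1) (a * b, 0)\<close>: the value at \<open>(a, 0)\<close> and \<open>(b, 0)\<close> cancels.\<close>
    show "universal_derivation (a * b) = vadd (dual_bimodule form_bimodule)
        (lact (dual_bimodule form_bimodule) a (universal_derivation b))
        (ract (dual_bimodule form_bimodule) (universal_derivation a) b)" for a b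
      by (auto simp: dual_bimodule_def universal_derivation_def fun_eq_iff restrict_def
          Z.lact_closed Z.ract_closed)
        (simp add: form_bimodule_simps umult_one_left umult_one_right umult_embed)
    show "universal_derivation a \<in> vcarrier (dual_bimodule form_bimodule)" for a
      using mem by (simp add: dual_bimodule_def)
    show "universal_derivation (a + b) = vadd (dual_bimodule form_bimodule)
        (universal_derivation a) (universal_derivation b)" for a b
      unfolding dual_bimodule_def universal_derivation_def
      by (rule ext) (simp add: emb form_bimodule_simps form_simps restrict_def del: add_Pair)
    show "universal_derivation (scl c a) = vscale (dual_bimodule form_bimodule) c
        (universal_derivation a)" for c a
      unfolding dual_bimodule_def universal_derivation_def
      by (rule ext) (simp add: emb form_bimodule_simps form_simps restrict_def)
  qed (rule cont)
qed

section \<open>A virtual diagonal from amenability\<close>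

text \<open>\<open>M\<close> plays the role of an element of the second dual of \<open>A\<^sup># \<otimes> A\<^sup>#\<close> that commutes with \<open>A\<close> and is
  mapped to \<open>1\<close> by the multiplication. The last clause expresses the latter, as forms that factor
  through the multiplication are the functionals on the product.\<close>
definition virtual_diagonal :: "(('a \<times> 'k \<Rightarrow> 'a \<times> 'k \<Rightarrow> 'k) \<Rightarrow> 'k) \<Rightarrow> bool" where
  "virtual_diagonal M \<longleftrightarrow>
    (\<forall>\<phi>\<in>forms. \<forall>\<psi>\<in>forms. M (\<lambda>p q. \<phi> p q + \<psi> p q) = M \<phi> + M \<psi>) \<and>
    (\<forall>c. \<forall>\<phi>\<in>forms. M (\<lambda>p q. c * \<phi> p q) = c * M \<phi>) \<and>
    (\<exists>C. \<forall>\<phi>\<in>forms. \<forall>K\<ge>0. form_bound \<phi> K \<longrightarrow> norm (M \<phi>) \<le> C * K) \<and>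
    (\<forall>c. \<forall>\<phi>\<in>forms. M (\<lambda>p q. \<phi> (umult (c, 0) p) q) = M (\<lambda>p q. \<phi> p (umult q (c, 0)))) \<and>
    (\<forall>g. (\<lambda>p q. g (umult p q)) \<in> forms \<longrightarrow> M (\<lambda>p q. g (umult p q)) = g (0, 1))"

text \<open>If \<open>N\<close> implements the universal derivation, then \<open>1 \<otimes> 1 + N\<close> commutes with \<open>A\<close>, and its image
  under the multiplication is that of \<open>1 \<otimes> 1\<close>, because \<open>N\<close> lives on the kernel. The map \<open>P\<close> in the proof
  restricts a form to that kernel.\<close>
lemma amenable_imp_virtual_diagonal:
  assumes "amenable_over TYPE(('k, 'a) bimod_universe) scl UNIV"
  shows "\<exists>M. virtual_diagonal M"
proof -
  interpret Z: banach_bimodule scl UNIV form_bimodule by (rule banach_bimodule_forms)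
  have "inner_derivation UNIV (dual_bimodule form_bimodule) universal_derivation"
    by (rule assms[unfolded amenable_over_def, rule_format,
        OF banach_bimodule_forms continuous_derivation_universal])
  then obtain N where N: "N \<in> bounded_functionals form_bimodule"
    and inner: "\<And>c. universal_derivation c = vdiff (dual_bimodule form_bimodule)
        (lact (dual_bimodule form_bimodule) c N) (ract (dual_bimodule form_bimodule) N c)"
    unfolding inner_derivation_def by (auto simp: dual_bimodule_def)
  have N_inner: "\<phi> (0, 1) (c, 0) = N (ract form_bimodule \<phi> c) - N (lact form_bimodule c \<phi>)"
    if "\<phi> \<in> vcarrier form_bimodule" for \<phi> c
    using fun_cong[OF inner[of c], of \<phi>] that
    by (simp add: universal_derivation_def vdiff_def dual_bimodule_def)
  obtain L where L: "\<And>\<phi>. \<phi> \<in> vcarrier form_bimodule \<Longrightarrow> norm (N \<phi>) \<le> L * vnorm form_bimodule \<phi>"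
    using N unfolding bounded_functionals_def by blast
  define P where "P \<phi> = (\<lambda>p q. \<phi> p q - \<phi> (umult p q) (0, 1))" for \<phi> :: "'a \<times> 'k \<Rightarrow> 'a \<times> 'k \<Rightarrow> 'k"
  define M where "M \<phi> = \<phi> (0, 1) (0, 1) + N (P \<phi>)" for \<phi>
  have P: "P \<phi> \<in> vcarrier form_bimodule" if "\<phi> \<in> forms" for \<phi>
    using that by (simp add: P_def form_bimodule_simps forms_diff forms_translate umult_one_right)
  have N_add: "N (\<lambda>p q. \<phi> p q + \<psi> p q) = N \<phi> + N \<psi>"
    if "\<phi> \<in> vcarrier form_bimodule" "\<psi> \<in> vcarrier form_bimodule" for \<phi> \<psi>
    using N that unfolding bounded_functionals_def by (force simp: form_bimodule_simps)
  have N_scale: "N (\<lambda>p q. c * \<phi> p q) = c * N \<phi>" if "\<phi> \<in> vcarrier form_bimodule" for c \<phi>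
    using N that unfolding bounded_functionals_def by (force simp: form_bimodule_simps)
  have "virtual_diagonal M"
    unfolding virtual_diagonal_def
  proof (intro conjI ballI allI impI)
    fix \<phi> \<psi> assume \<phi>: "\<phi> \<in> forms" and \<psi>: "\<psi> \<in> forms"
    have "P (\<lambda>p q. \<phi> p q + \<psi> p q) = (\<lambda>p q. P \<phi> p q + P \<psi> p q)"
      by (simp add: P_def fun_eq_iff)
    then show "M (\<lambda>p q. \<phi> p q + \<psi> p q) = M \<phi> + M \<psi>"
      by (simp add: M_def N_add[OF P[OF \<phi>] P[OF \<psi>]])
  next
    fix c \<phi> assume \<phi>: "\<phi> \<in> forms"
    have "P (\<lambda>p q. c * \<phi> p q) = (\<lambda>p q. c * P \<phi> p q)"
      by (simp add: P_def fun_eq_iff algebra_simps)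
    then show "M (\<lambda>p q. c * \<phi> p q) = c * M \<phi>"
      by (simp add: M_def N_scale[OF P[OF \<phi>]] algebra_simps)
  next
    show "\<exists>C. \<forall>\<phi>\<in>forms. \<forall>K\<ge>0. form_bound \<phi> K \<longrightarrow> norm (M \<phi>) \<le> C * K"
    proof (intro exI ballI allI impI)
      fix \<phi> K assume \<phi>: "\<phi> \<in> forms" and K: "0 \<le> K" "form_bound \<phi> K"
      have 1: "norm ((0, 1) :: 'a \<times> 'k) = 1" by (simp add: norm_Pair)
      have "form_bound (P \<phi>) (5 * K)"
        using form_bound_diff[OF K(2) form_bound_translate(3)[OF K(2,1), of "(0, 1)"]]
        by (simp add: P_def 1)
      then have "vnorm form_bimodule (P \<phi>) \<le> 5 * K"
        using K(1) by (intro form_norm_le P \<phi>) auto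
      then have "\<bar>L\<bar> * vnorm form_bimodule (P \<phi>) \<le> \<bar>L\<bar> * (5 * K)" by (rule mult_left_mono) simp
      moreover have "L * vnorm form_bimodule (P \<phi>) \<le> \<bar>L\<bar> * vnorm form_bimodule (P \<phi>)"
        by (intro mult_right_mono form_eval.vnorm_nonneg P \<phi>) simp
      moreover have "norm (\<phi> (0, 1) (0, 1)) \<le> K"
        using K(2) unfolding form_bound_def by (metis 1 mult.right_neutral)
      ultimately have "norm (M \<phi>) \<le> K + \<bar>L\<bar> * (5 * K)"
        using L[OF P[OF \<phi>]] unfolding M_def by (intro norm_triangle_le) linarith
      then show "norm (M \<phi>) \<le> (1 + \<bar>L\<bar> * 5) * K" by (simp add: algebra_simps)
    qed
  next
    fix c \<phi> assume \<phi>: "\<phi> \<in> forms"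
    have "P (\<lambda>p q. \<phi> (umult (c, 0) p) q) = ract form_bimodule (P \<phi>) c"
      "P (\<lambda>p q. \<phi> p (umult q (c, 0))) = lact form_bimodule c (P \<phi>)"
      by (simp_all add: P_def form_bimodule_simps umult_assoc umult_one_left umult_one_right)
    then show "M (\<lambda>p q. \<phi> (umult (c, 0) p) q) = M (\<lambda>p q. \<phi> p (umult q (c, 0)))"
      using N_inner[OF P[OF \<phi>], of c]
      by (simp add: M_def P_def umult_one_left umult_one_right algebra_simps)
  next
    fix g assume "(\<lambda>p q. g (umult p q)) \<in> forms"
    have "P (\<lambda>p q. g (umult p q)) = (\<lambda>p q. 0 * (0::'k))"
      by (simp add: P_def umult_one_right)
    moreover have "N (\<lambda>p q. 0 * (0::'k)) = 0"
      using N_scale[OF form_eval.zero_mem, of 0] by (simp add: form_bimodule_simps)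
    ultimately show "M (\<lambda>p q. g (umult p q)) = g (0, 1)"
      by (simp add: M_def umult_one_left)
  qed
  then show ?thesis by blast
qed

end

section \<open>Averaging a derivation over the diagonal\<close>

lemma (in banach_algebra) forms_double_Lim:
  assumes U: "ultrafilter U" and h: "\<And>b b'. h b b' \<in> forms" "\<And>b b'. form_bound (h b b') K"
  shows "(\<lambda>p q. double_Lim U (\<lambda>b b'. h b b' p q)) \<in> forms"
    and "form_bound (\<lambda>p q. double_Lim U (\<lambda>b b'. h b b' p q)) K"
proof -
  have bd: "norm (h b b' p q) \<le> K * norm p * norm q" for b b' p q
    using h(2) by (simp add: form_bound_def)
  show *: "form_bound (\<lambda>p q. double_Lim U (\<lambda>b b'. h b b' p q)) K"
    unfolding form_bound_def by (intro allI norm_double_Lim_le[OF U] bd)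
  show "(\<lambda>p q. double_Lim U (\<lambda>b b'. h b b' p q)) \<in> forms"
    by (rule formsI[OF _ _ _ _ *])
      (simp_all add: form_simps[OF h(1)] double_Lim_add[OF U bd bd] double_Lim_mult[OF U bd])
qed

text \<open>A bounded derivation from \<open>I\<close> into the dual of \<open>Z\<close> is given as a pairing \<open>d c z = \<langle>D c, z\<rangle>\<close>, in which
  the dual module actions become actions on \<open>z\<close>.\<close>
locale ideal_derivation = banach_algebra scl + Z: banach_bimodule scl I Z
  for scl :: "'k::{real_normed_field,heine_borel} \<Rightarrow> 'a::{real_normed_algebra,banach} \<Rightarrow> 'a"
    and I :: "'a set" and Z :: "('k, 'a, 'z) bimod" +
  fixes U :: "'i filter" and e :: "'i \<Rightarrow> 'a" and E :: real
    and d :: "'a \<Rightarrow> 'z \<Rightarrow> 'k" and R K :: real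
    and M :: "('a \<times> 'k \<Rightarrow> 'a \<times> 'k \<Rightarrow> 'k) \<Rightarrow> 'k"
  assumes subspace: "subspace I" and left_ideal: "x \<in> I \<Longrightarrow> a * x \<in> I"
    and U: "ultrafilter U"
    and e_mem: "e b \<in> I" and e_bound: "norm (e b) \<le> E"
    and e_left: "c \<in> I \<Longrightarrow> ((\<lambda>b. e b * c) \<longlongrightarrow> c) U"
    and e_right: "c \<in> I \<Longrightarrow> ((\<lambda>b. c * e b) \<longlongrightarrow> c) U"
    and d_add: "\<lbrakk>x \<in> I; y \<in> I; z \<in> vcarrier Z\<rbrakk> \<Longrightarrow> d (x + y) z = d x z + d y z"
    and d_scale: "\<lbrakk>x \<in> I; z \<in> vcarrier Z\<rbrakk> \<Longrightarrow> d (scl k x) z = k * d x z"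
    and d_vadd: "\<lbrakk>x \<in> I; z \<in> vcarrier Z; z' \<in> vcarrier Z\<rbrakk> \<Longrightarrow> d x (vadd Z z z') = d x z + d x z'"
    and d_vscale: "\<lbrakk>x \<in> I; z \<in> vcarrier Z\<rbrakk> \<Longrightarrow> d x (vscale Z k z) = k * d x z"
    and d_mult: "\<lbrakk>x \<in> I; y \<in> I; z \<in> vcarrier Z\<rbrakk> \<Longrightarrow> d (x * y) z = d y (ract Z z x) + d x (lact Z y z)"
    and K_nonneg: "0 \<le> K"
    and d_bound: "\<lbrakk>x \<in> I; z \<in> vcarrier Z\<rbrakk> \<Longrightarrow> norm (d x z) \<le> K * norm x * vnorm Z z"
    and R_nonneg: "0 \<le> R"
    and ract_bound: "\<lbrakk>x \<in> I; z \<in> vcarrier Z\<rbrakk> \<Longrightarrow> vnorm Z (ract Z z x) \<le> R * norm x * vnorm Z z"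
    and M: "virtual_diagonal M"
begin

lemma E_nonneg: "0 \<le> E"
  using e_bound norm_ge_zero order_trans by blast

lemma uact_mem: "x \<in> I \<Longrightarrow> uact p x \<in> I"
  unfolding uact_def by (intro subspace_add[OF subspace] subspace_scale[OF subspace] left_ideal)

lemmas closed = uact_mem e_mem left_ideal Z.lact_closed Z.ract_closed Z.add_closed Z.scale_closed

lemma d_tendsto:
  assumes "(f \<longlongrightarrow> x) U" "\<And>b. f b \<in> I" "x \<in> I" "z \<in> vcarrier Z"
  shows "((\<lambda>b. d (uact p (f b)) z) \<longlongrightarrow> d (uact p x) z) U"
proof (rule Lim_transform2[OF tendsto_const])
  have *: "norm (d (uact p x) z - d (uact p (f b)) z) \<le> K * (2 * norm p * norm (f b - x)) * vnorm Z z" for b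
  proof -
    have mem: "f b - x \<in> I" by (intro subspace_diff[OF subspace] assms)
    have "d (uact p (f b)) z = d (uact p (f b - x) + uact p x) z"
      by (simp add: uact_diff_right)
    also have "\<dots> = d (uact p (f b - x)) z + d (uact p x) z"
      using mem assms by (intro d_add closed)
    finally have "norm (d (uact p x) z - d (uact p (f b)) z) = norm (d (uact p (f b - x)) z)" by simp
    also have "\<dots> \<le> K * norm (uact p (f b - x)) * vnorm Z z"
      using mem assms by (intro d_bound closed)
    also have "\<dots> \<le> K * (2 * norm p * norm (f b - x)) * vnorm Z z"
      using assms by (intro mult_right_mono mult_left_mono norm_uact_le K_nonneg Z.norm_nonneg)
    finally show ?thesis .
  qed
  have "((\<lambda>b. K * (2 * norm p * norm (f b - x)) * vnorm Z z) \<longlongrightarrow> K * (2 * norm p * norm (x - x)) * vnorm Z z) U"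
    by (intro tendsto_intros assms(1))
  then have 0: "((\<lambda>b. K * (2 * norm p * norm (f b - x)) * vnorm Z z) \<longlongrightarrow> 0) U" by simp
  show "((\<lambda>b. d (uact p x) z - d (uact p (f b)) z) \<longlongrightarrow> 0) U"
    by (rule Lim_null_comparison[OF _ 0]) (use * in simp)
qed

text \<open>The value of \<open>M\<close> at this form is the average of \<open>\<langle>a e \<cdot> D (b e'), z\<rangle>\<close> over the diagonal \<open>a \<otimes> b\<close>.\<close>
definition diag_form :: "'z \<Rightarrow> 'a \<times> 'k \<Rightarrow> 'a \<times> 'k \<Rightarrow> 'k" where
  "diag_form z p q = double_Lim U (\<lambda>b b'. d (uact q (e b')) (ract Z z (uact p (e b))))"

text \<open>The value of \<open>M\<close> at this form is the average of \<open>\<langle>D (a e b e'), z\<rangle>\<close>. It arises from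
  \<open>x \<cdot> D c = D (x c) - D x \<cdot> c\<close>, with \<open>x = p e q e'\<close>.\<close>
definition mult_form :: "'z \<Rightarrow> 'a \<times> 'k \<Rightarrow> 'a \<times> 'k \<Rightarrow> 'k" where
  "mult_form z p q = double_Lim U (\<lambda>b b'. d (uact p (e b * uact q (e b'))) z)"

lemma norm_uact_e: "norm (uact p (e b)) \<le> 2 * norm p * E"
  by (rule order_trans[OF norm_uact_le]) (simp add: mult_left_mono e_bound)

lemma d_bound_le:
  assumes "x \<in> I" "z \<in> vcarrier Z" "norm x \<le> A" "vnorm Z z \<le> B"
  shows "norm (d x z) \<le> K * A * B"
  by (rule order_trans[OF d_bound[OF assms(1,2)]])
    (intro mult_mono mult_left_mono assms mult_nonneg_nonneg K_nonneg Z.norm_nonneg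
      order_trans[OF norm_ge_zero assms(3)])

lemma diag_pre_bound:
  assumes z: "z \<in> vcarrier Z"
  shows "norm (d (uact q (e b')) (ract Z z (uact p (e b)))) \<le> 4 * K * R * E * E * vnorm Z z * norm p * norm q"
proof -
  have "vnorm Z (ract Z z (uact p (e b))) \<le> R * norm (uact p (e b)) * vnorm Z z"
    using z by (intro ract_bound closed)
  also have "\<dots> \<le> R * (2 * norm p * E) * vnorm Z z"
    by (intro mult_right_mono mult_left_mono norm_uact_e R_nonneg Z.norm_nonneg z)
  finally have "norm (d (uact q (e b')) (ract Z z (uact p (e b)))) \<le> K * (2 * norm q * E) * (R * (2 * norm p * E) * vnorm Z z)"
    using z by (intro d_bound_le closed norm_uact_e)
  then show ?thesis by (simp add: mult_ac)
qed

lemma mult_pre_bound: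
  assumes z: "z \<in> vcarrier Z"
  shows "norm (d (uact p (e b * uact q (e b'))) z) \<le> 4 * K * E * E * vnorm Z z * norm p * norm q"
proof -
  have "norm (e b * uact q (e b')) \<le> E * (2 * norm q * E)"
    by (rule order_trans[OF norm_mult_ineq]) (intro mult_mono e_bound norm_uact_e E_nonneg norm_ge_zero)
  then have "norm (uact p (e b * uact q (e b'))) \<le> 2 * norm p * (E * (2 * norm q * E))"
    by (intro order_trans[OF norm_uact_le] mult_left_mono) auto
  then have "norm (d (uact p (e b * uact q (e b'))) z) \<le> K * (2 * norm p * (E * (2 * norm q * E))) * vnorm Z z"
    using z by (intro d_bound_le closed) auto
  then show ?thesis by (simp add: mult_ac)
qed

lemmas uact_linear = uact_add_left uact_add_right uact_scale_left uact_scale_right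

lemma
  assumes z: "z \<in> vcarrier Z"
  shows diag_form: "diag_form z \<in> forms" "form_bound (diag_form z) (4 * K * R * E * E * vnorm Z z)"
    and mult_form: "mult_form z \<in> forms" "form_bound (mult_form z) (4 * K * E * E * vnorm Z z)"
proof -
  have b1: "form_bound (\<lambda>p q. d (uact q (e b')) (ract Z z (uact p (e b)))) (4 * K * R * E * E * vnorm Z z)" for b b'
    unfolding form_bound_def using diag_pre_bound[OF z] by blast
  have f1: "(\<lambda>p q. d (uact q (e b')) (ract Z z (uact p (e b)))) \<in> forms" for b b'
    by (rule formsI[OF _ _ _ _ b1])
      (simp_all add: uact_linear d_add d_scale d_vadd d_vscale Z.ract_add_right Z.ract_scale_right closed z)
  show "diag_form z \<in> forms" "form_bound (diag_form z) (4 * K * R * E * E * vnorm Z z)"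
    using forms_double_Lim[OF U f1 b1] by (simp_all add: diag_form_def[abs_def])
  have b2: "form_bound (\<lambda>p q. d (uact p (e b * uact q (e b'))) z) (4 * K * E * E * vnorm Z z)" for b b'
    unfolding form_bound_def using mult_pre_bound[OF z] by blast
  have f2: "(\<lambda>p q. d (uact p (e b * uact q (e b'))) z) \<in> forms" for b b'
    by (rule formsI[OF _ _ _ _ b2])
      (simp_all add: uact_linear distrib_left mult_scale_right d_add d_scale closed z)
  show "mult_form z \<in> forms" "form_bound (mult_form z) (4 * K * E * E * vnorm Z z)"
    using forms_double_Lim[OF U f2 b2] by (simp_all add: mult_form_def[abs_def])
qed

lemma diag_form_add:
  assumes "y \<in> vcarrier Z" "z \<in> vcarrier Z"
  shows "diag_form (vadd Z y z) = (\<lambda>p q. diag_form y p q + diag_form z p q)"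
  using assms unfolding diag_form_def
  by (intro ext) (simp add: Z.ract_add_left d_vadd closed double_Lim_add[OF U diag_pre_bound diag_pre_bound])

lemma diag_form_scale:
  assumes "z \<in> vcarrier Z"
  shows "diag_form (vscale Z k z) = (\<lambda>p q. k * diag_form z p q)"
  using assms unfolding diag_form_def
  by (intro ext) (simp add: Z.ract_scale_left d_vscale closed double_Lim_mult[OF U diag_pre_bound])

lemma mult_form_add:
  assumes "y \<in> vcarrier Z" "z \<in> vcarrier Z"
  shows "mult_form (vadd Z y z) = (\<lambda>p q. mult_form y p q + mult_form z p q)"
  using assms unfolding mult_form_def
  by (intro ext) (simp add: d_vadd closed double_Lim_add[OF U mult_pre_bound mult_pre_bound])

lemma mult_form_scale:
  assumes "z \<in> vcarrier Z"
  shows "mult_form (vscale Z k z) = (\<lambda>p q. k * mult_form z p q)"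
  using assms unfolding mult_form_def
  by (intro ext) (simp add: d_vscale closed double_Lim_mult[OF U mult_pre_bound])

lemma M_add: "\<phi> \<in> forms \<Longrightarrow> \<psi> \<in> forms \<Longrightarrow> M (\<lambda>p q. \<phi> p q + \<psi> p q) = M \<phi> + M \<psi>"
  and M_scale: "\<phi> \<in> forms \<Longrightarrow> M (\<lambda>p q. k * \<phi> p q) = k * M \<phi>"
  and M_bound: "\<exists>C. \<forall>\<phi>\<in>forms. \<forall>K\<ge>0. form_bound \<phi> K \<longrightarrow> norm (M \<phi>) \<le> C * K"
  and M_commute: "\<phi> \<in> forms \<Longrightarrow> M (\<lambda>p q. \<phi> (umult (c, 0) p) q) = M (\<lambda>p q. \<phi> p (umult q (c, 0)))"
  and M_normal: "(\<lambda>p q. g (umult p q)) \<in> forms \<Longrightarrow> M (\<lambda>p q. g (umult p q)) = g (0, 1)"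
  using M unfolding virtual_diagonal_def by blast+

text \<open>Compare the two sides of \<open>M_commute\<close> for the form \<open>diag_form z\<close>. Multiplying the first argument by
  \<open>c\<close> replaces \<open>z\<close> by \<open>z \<cdot> c\<close>. Multiplying the second one turns \<open>D (q e')\<close> into \<open>D (q c e')\<close>, which may be
  replaced by \<open>D (q e' c)\<close> in the limit; the derivation rule then splits it into the form for \<open>c \<cdot> z\<close> and
  a remainder whose main part \<open>D (p q c)\<close> depends on the product \<open>p q\<close> only.\<close>
lemma derivation_as_diagonal_average:
  assumes c: "c \<in> I" and z: "z \<in> vcarrier Z"
  shows "d c z = M (diag_form (ract Z z c)) - M (diag_form (lact Z c z)) + M (mult_form (lact Z c z))"
proof -
  have cz: "lact Z c z \<in> vcarrier Z" using c z by (rule Z.lact_closed)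
  have left: "diag_form z (umult (c, 0) p) q = diag_form (ract Z z c) p q" for p q
    unfolding diag_form_def using c z by (simp add: uact_umult uact_embed Z.ract_mult closed)
  define g where "g r = d (uact r c) z" for r
  have right: "diag_form z p (umult q (c, 0)) =
      g (umult p q) + (- 1 * mult_form (lact Z c z) p q + diag_form (lact Z c z) p q)" for p q
  proof -
    define y where "y b = ract Z z (uact p (e b))" for b
    have y: "y b \<in> vcarrier Z" for b unfolding y_def using z by (intro closed)
    define X where "X b b' = d (uact p (e b * uact q (e b' * c))) z" for b b'
    have nb: "U \<noteq> bot" using U by (simp add: ultrafilter_def)
    \<comment> \<open>Both limits are \<open>d (uact q c) (y b)\<close>; this uses that the approximate identity is two-sided.\<close>
    have "Lim U (\<lambda>b'. d (uact q (c * e b')) (y b)) = Lim U (\<lambda>b'. d (uact q (e b' * c)) (y b))" for b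
      using d_tendsto[OF e_left[OF c] _ c y, of q b] d_tendsto[OF e_right[OF c] _ c y, of q b] c
      by (simp add: closed tendsto_Lim[OF nb])
    then have "diag_form z p (umult q (c, 0)) = double_Lim U (\<lambda>b b'. d (uact q (e b' * c)) (y b))"
      by (simp add: diag_form_def double_Lim_def uact_umult uact_embed y_def)
    also have "(\<lambda>b b'. d (uact q (e b' * c)) (y b)) =
      (\<lambda>b b'. X b b' + (- 1 * d (uact p (e b * uact q (e b'))) (lact Z c z)
        + d (uact q (e b')) (ract Z (lact Z c z) (uact p (e b)))))"
    proof (intro ext)
      fix b b'
      have "d (uact q (e b' * c)) (y b) = d (uact q (e b') * c) (y b)"
        by (simp add: uact_times)
      also have "\<dots> = d c (ract Z (y b) (uact q (e b'))) + d (uact q (e b')) (lact Z c (y b))"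
        using c y by (intro d_mult closed)
      also have "ract Z (y b) (uact q (e b')) = ract Z z (uact p (e b * uact q (e b')))"
        unfolding y_def uact_times[symmetric] using z by (simp add: Z.ract_mult closed)
      also have "lact Z c (y b) = ract Z (lact Z c z) (uact p (e b))"
        unfolding y_def using c z by (simp add: Z.lact_ract closed)
      also have "d c (ract Z z (uact p (e b * uact q (e b')))) =
          X b b' - d (uact p (e b * uact q (e b'))) (lact Z c z)"
        using d_mult[of "uact p (e b * uact q (e b'))" c z] c z
        by (simp add: X_def uact_times mult.assoc closed)
      finally show "d (uact q (e b' * c)) (y b) =
        X b b' + (- 1 * d (uact p (e b * uact q (e b'))) (lact Z c z)
        + d (uact q (e b')) (ract Z (lact Z c z) (uact p (e b))))" by simp
    qed
    also have "double_Lim U \<dots> = double_Lim U X + (- 1 * mult_form (lact Z c z) p q + diag_form (lact Z c z) p q)"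
    proof -
      have "norm (e b' * c) \<le> E * norm c" for b'
        by (rule order_trans[OF norm_mult_ineq]) (intro mult_right_mono e_bound norm_ge_zero)
      then have "norm (uact q (e b' * c)) \<le> 2 * norm q * (E * norm c)" for b'
        by (intro order_trans[OF norm_uact_le] mult_left_mono) auto
      then have "norm (e b * uact q (e b' * c)) \<le> E * (2 * norm q * (E * norm c))" for b b'
        by (intro order_trans[OF norm_mult_ineq] mult_mono e_bound E_nonneg) auto
      then have "norm (uact p (e b * uact q (e b' * c))) \<le> 2 * norm p * (E * (2 * norm q * (E * norm c)))" for b b'
        by (intro order_trans[OF norm_uact_le] mult_left_mono) auto
      then have X: "norm (X b b') \<le> K * (2 * norm p * (E * (2 * norm q * (E * norm c)))) * vnorm Z z" for b b'
        unfolding X_def using c z by (intro d_bound_le closed) auto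
      have T: "norm (- 1 * d (uact p (e b * uact q (e b'))) (lact Z c z))
          \<le> 4 * K * E * E * vnorm Z (lact Z c z) * norm p * norm q" for b b'
        using mult_pre_bound[OF cz, of p b q b'] by simp
      have S: "norm (- 1 * d (uact p (e b * uact q (e b'))) (lact Z c z)
          + d (uact q (e b')) (ract Z (lact Z c z) (uact p (e b))))
        \<le> 4 * K * E * E * vnorm Z (lact Z c z) * norm p * norm q
          + 4 * K * R * E * E * vnorm Z (lact Z c z) * norm p * norm q" for b b'
        by (intro norm_triangle_le add_mono T diag_pre_bound cz)
      show ?thesis
        unfolding double_Lim_add[OF U X S] double_Lim_add[OF U T diag_pre_bound[OF cz]]
          double_Lim_mult[OF U mult_pre_bound[OF cz]] mult_form_def diag_form_def ..
    qed
    \<comment> \<open>First \<open>e' c\<close> tends to \<open>c\<close>; then \<open>e (q c)\<close> tends to \<open>q c\<close>, because \<open>q c\<close> lies in the left ideal.\<close>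
    also have "double_Lim U X = g (umult p q)"
    proof (rule double_Lim_eqI[OF U])
      show "(X b \<longlongrightarrow> d (uact p (e b * uact q c)) z) U" for b
      proof -
        have "((\<lambda>b'. d (uact (umult (umult p (e b, 0)) q) (e b' * c)) z)
            \<longlongrightarrow> d (uact (umult (umult p (e b, 0)) q) c) z) U"
          using c z by (intro d_tendsto e_left closed)
        then show ?thesis by (simp add: X_def[abs_def] uact_umult uact_embed)
      qed
      show "((\<lambda>b. d (uact p (e b * uact q c)) z) \<longlongrightarrow> g (umult p q)) U"
        unfolding g_def uact_umult using c z by (intro d_tendsto e_left closed)
    qed
    finally show ?thesis .
  qed
  have g: "(\<lambda>p q. g (umult p q)) \<in> forms"
  proof (rule formsI)
    show "form_bound (\<lambda>p q. g (umult p q)) (4 * K * norm c * vnorm Z z)"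
      unfolding form_bound_def
    proof (intro allI)
      fix p q
      have "norm (uact p (uact q c)) \<le> 2 * norm p * (2 * norm q * norm c)"
        by (rule order_trans[OF norm_uact_le]) (intro mult_left_mono norm_uact_le, simp)
      then have "norm (g (umult p q)) \<le> K * (2 * norm p * (2 * norm q * norm c)) * vnorm Z z"
        unfolding g_def uact_umult using c z by (intro d_bound_le closed) auto
      then show "norm (g (umult p q)) \<le> 4 * K * norm c * vnorm Z z * norm p * norm q"
        by (simp add: mult_ac)
    qed
  qed (simp_all add: g_def uact_umult uact_linear d_add d_scale closed c z)
  have "M (diag_form (ract Z z c)) = M (\<lambda>p q. diag_form z (umult (c, 0) p) q)"
    by (simp add: left)
  also have "\<dots> = M (\<lambda>p q. diag_form z p (umult q (c, 0)))"
    by (rule M_commute[OF diag_form(1)[OF z]])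
  also have "\<dots> = M (\<lambda>p q. g (umult p q)) + (- 1 * M (mult_form (lact Z c z)) + M (diag_form (lact Z c z)))"
    unfolding right using forms_scale[OF mult_form(1)[OF cz], of "-1"] diag_form(1)[OF cz] g
    by (simp only: M_add forms_add M_scale mult_form(1)[OF cz])
  also have "M (\<lambda>p q. g (umult p q)) = g (0, 1)"
    by (rule M_normal[OF g])
  also have "g (0, 1) = d c z"
    by (simp add: g_def uact_one)
  finally show ?thesis by simp
qed

definition functional :: "('z \<Rightarrow> 'k) \<Rightarrow> bool" where
  "functional f \<longleftrightarrow> restrict f (vcarrier Z) \<in> bounded_functionals Z"

lemma functional_iff:
  "functional f \<longleftrightarrow> (\<forall>x\<in>vcarrier Z. \<forall>y\<in>vcarrier Z. f (vadd Z x y) = f x + f y) \<and>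
     (\<forall>c. \<forall>x\<in>vcarrier Z. f (vscale Z c x) = c * f x) \<and>
     (\<exists>K. \<forall>x\<in>vcarrier Z. norm (f x) \<le> K * vnorm Z x)"
  by (auto simp: functional_def bounded_functionals_def Z.add_closed Z.scale_closed)

lemma functional_M:
  assumes "\<And>z. z \<in> vcarrier Z \<Longrightarrow> F z \<in> forms"
    and "\<And>z. z \<in> vcarrier Z \<Longrightarrow> form_bound (F z) (C * vnorm Z z)" "0 \<le> C"
    and "\<And>y z. y \<in> vcarrier Z \<Longrightarrow> z \<in> vcarrier Z \<Longrightarrow> F (vadd Z y z) = (\<lambda>p q. F y p q + F z p q)"
    and "\<And>k z. z \<in> vcarrier Z \<Longrightarrow> F (vscale Z k z) = (\<lambda>p q. k * F z p q)"
  shows "functional (\<lambda>z. M (F z))"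
proof -
  obtain B where B: "\<And>\<phi> K. \<phi> \<in> forms \<Longrightarrow> 0 \<le> K \<Longrightarrow> form_bound \<phi> K \<Longrightarrow> norm (M \<phi>) \<le> B * K"
    using M_bound by blast
  have "norm (M (F z)) \<le> (B * C) * vnorm Z z" if "z \<in> vcarrier Z" for z
    using B[OF assms(1)[OF that] _ assms(2)[OF that]] Z.norm_nonneg[OF that] assms(3)
    by (simp add: mult_ac)
  then show ?thesis
    unfolding functional_iff by (auto simp: assms M_add M_scale)
qed

text \<open>With \<open>D c = c \<cdot> w - w \<cdot> c + v \<cdot> c\<close>, the derivation rule for \<open>D\<close> leaves \<open>c' \<cdot> v \<cdot> c = 0\<close>. Let \<open>u\<close> be the
  weak* limit of \<open>e \<cdot> v\<close>. Then \<open>c \<cdot> u = c \<cdot> v\<close> and \<open>u \<cdot> c = 0\<close>, so \<open>w - v + u\<close> implements \<open>D\<close>.\<close>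
lemma derivation_is_inner:
  "\<exists>f. functional f \<and> (\<forall>c\<in>I. \<forall>z\<in>vcarrier Z. d c z = f (ract Z z c) - f (lact Z c z))"
proof -
  define w where "w z = M (diag_form z)" for z
  define v where "v z = M (mult_form z)" for z
  have w: "functional w" unfolding w_def
    by (rule functional_M[where C = "4 * K * R * E * E"])
      (simp_all add: diag_form diag_form_add diag_form_scale K_nonneg R_nonneg E_nonneg)
  have v: "functional v" unfolding v_def
    by (rule functional_M[where C = "4 * K * E * E"])
      (simp_all add: mult_form mult_form_add mult_form_scale K_nonneg E_nonneg)
  have d: "d c z = w (ract Z z c) - w (lact Z c z) + v (lact Z c z)" if "c \<in> I" "z \<in> vcarrier Z" for c z
    unfolding w_def v_def by (rule derivation_as_diagonal_average[OF that])
  \<comment> \<open>Expanding both sides of the derivation rule by \<open>d\<close> leaves only this value of \<open>c' \<cdot> v \<cdot> c\<close>.\<close>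
  have v0: "v (ract Z (lact Z c z) c') = 0" if c: "c \<in> I" "c' \<in> I" and z: "z \<in> vcarrier Z" for c c' z
  proof -
    have "d (c' * c) z = d c (ract Z z c') + d c' (lact Z c z)" using c z by (intro d_mult)
    then show ?thesis using c z
      by (simp add: d closed Z.ract_mult Z.lact_mult Z.lact_ract)
  qed
  obtain B where B: "0 \<le> B" "\<And>z. z \<in> vcarrier Z \<Longrightarrow> norm (v z) \<le> B * vnorm Z z"
  proof -
    obtain B where B: "\<And>z. z \<in> vcarrier Z \<Longrightarrow> norm (v z) \<le> B * vnorm Z z"
      using v unfolding functional_iff by blast
    have "norm (v z) \<le> \<bar>B\<bar> * vnorm Z z" if "z \<in> vcarrier Z" for z
      by (rule order_trans[OF B[OF that] mult_right_mono[OF abs_ge_self Z.norm_nonneg[OF that]]])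
    then show ?thesis by (intro that[of "\<bar>B\<bar>"]) simp_all
  qed
  define u where "u z = Lim U (\<lambda>b. v (ract Z z (e b)))" for z
  have ract_e: "vnorm Z (ract Z z (e b)) \<le> R * E * vnorm Z z" if "z \<in> vcarrier Z" for z b
    using that by (intro order_trans[OF ract_bound] mult_right_mono mult_left_mono R_nonneg e_bound e_mem Z.norm_nonneg)
  have bd: "norm (v (ract Z z (e b))) \<le> B * (R * E * vnorm Z z)" if "z \<in> vcarrier Z" for z b
    using that by (intro order_trans[OF B(2)] mult_left_mono B(1) ract_e closed)
  have v_lin: "v (vadd Z x y) = v x + v y" "v (vscale Z k x) = k * v x"
    if "x \<in> vcarrier Z" "y \<in> vcarrier Z" for x y k
    using v that by (auto simp: functional_iff)
  have w_lin: "w (vadd Z x y) = w x + w y" "w (vscale Z k x) = k * w x"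
    if "x \<in> vcarrier Z" "y \<in> vcarrier Z" for x y k
    using w that by (auto simp: functional_iff)
  have u_bd: "norm (u z) \<le> B * (R * E * vnorm Z z)" if "z \<in> vcarrier Z" for z
    unfolding u_def by (rule norm_Lim_le[OF U bd[OF that]])
  have u_add: "u (vadd Z x y) = u x + u y" if "x \<in> vcarrier Z" "y \<in> vcarrier Z" for x y
    unfolding u_def using that
    by (simp add: Z.ract_add_left v_lin closed Lim_add[OF U bd bd])
  have u_scale: "u (vscale Z k x) = k * u x" if "x \<in> vcarrier Z" for x k
    unfolding u_def using that
    by (simp add: Z.ract_scale_left v_lin(2)[OF _ Z.zero_closed] closed Lim_mult[OF U bd])
  have u_ract: "u (ract Z z c) = v (ract Z z c)" if c: "c \<in> I" and z: "z \<in> vcarrier Z" for c z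
  proof -
    have "((\<lambda>b. v (ract Z z (c * e b))) \<longlongrightarrow> v (ract Z z c)) U"
    proof (rule Lim_transform2[OF tendsto_const])
      have le: "norm (v (ract Z z c) - v (ract Z z (c * e b))) \<le> B * (R * norm (c * e b - c) * vnorm Z z)" for b
      proof -
        have mem: "c * e b - c \<in> I" by (intro subspace_diff[OF subspace] closed c)
        have "v (ract Z z (c * e b)) = v (ract Z z ((c * e b - c) + c))" by simp
        also have "\<dots> = v (ract Z z (c * e b - c)) + v (ract Z z c)"
          unfolding Z.ract_add_right[OF mem c z] by (intro v_lin closed mem c z)
        finally have "norm (v (ract Z z c) - v (ract Z z (c * e b))) = norm (v (ract Z z (c * e b - c)))"
          by simp
        also have "\<dots> \<le> B * (R * norm (c * e b - c) * vnorm Z z)"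
          by (intro order_trans[OF B(2)] mult_left_mono B(1) ract_bound closed mem z)
        finally show ?thesis .
      qed
      have "((\<lambda>b. B * (R * norm (c * e b - c) * vnorm Z z)) \<longlongrightarrow> B * (R * norm (c - c) * vnorm Z z)) U"
        by (intro tendsto_intros e_right c)
      then have 0: "((\<lambda>b. B * (R * norm (c * e b - c) * vnorm Z z)) \<longlongrightarrow> 0) U" by simp
      show "((\<lambda>b. v (ract Z z c) - v (ract Z z (c * e b))) \<longlongrightarrow> 0) U"
        by (rule Lim_null_comparison[OF _ 0]) (use le in simp)
    qed
    then have "Lim U (\<lambda>b. v (ract Z z (c * e b))) = v (ract Z z c)"
      using U by (intro tendsto_Lim) (auto simp: ultrafilter_def)
    then show ?thesis unfolding u_def using c z by (simp add: Z.ract_mult closed)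
  qed
  have u_lact: "u (lact Z c z) = 0" if "c \<in> I" "z \<in> vcarrier Z" for c z
  proof -
    have nb: "U \<noteq> bot" using U by (simp add: ultrafilter_def)
    show ?thesis unfolding u_def using that by (simp add: v0 e_mem tendsto_Lim[OF nb tendsto_const])
  qed
  define f where "f z = w z - v z + u z" for z
  have "functional f"
  proof -
    obtain A where A: "\<And>z. z \<in> vcarrier Z \<Longrightarrow> norm (w z) \<le> A * vnorm Z z"
      using w unfolding functional_iff by blast
    have "norm (f z) \<le> (A + B + B * (R * E)) * vnorm Z z" if z: "z \<in> vcarrier Z" for z
    proof -
      have "norm (f z) \<le> norm (w z) + norm (v z) + norm (u z)"
        unfolding f_def using norm_triangle_ineq[of "w z - v z" "u z"] norm_triangle_ineq4[of "w z" "v z"]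
        by linarith
      with A[OF z] B(2)[OF z] u_bd[OF z] show ?thesis by (simp add: algebra_simps)
    qed
    moreover have "f (vadd Z x y) = f x + f y" if "x \<in> vcarrier Z" "y \<in> vcarrier Z" for x y
      using that by (simp add: f_def v_lin w_lin u_add)
    moreover have "f (vscale Z k x) = k * f x" if "x \<in> vcarrier Z" for k x
      using v_lin(2)[OF that that] w_lin(2)[OF that that] u_scale[OF that] by (simp add: f_def algebra_simps)
    ultimately show ?thesis unfolding functional_iff by blast
  qed
  moreover have "d c z = f (ract Z z c) - f (lact Z c z)" if "c \<in> I" "z \<in> vcarrier Z" for c z
    using that by (simp add: d f_def u_ract u_lact)
  ultimately show ?thesis by blast
qed

end

section \<open>Amenability of the ideal\<close>

lemma net_filter_neq_bot:
  assumes "directed_set B le"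
  shows "net_filter B le \<noteq> bot"
proof
  assume "net_filter B le = bot"
  then have "eventually (\<lambda>_. False) (INF b\<in>B. principal {b' \<in> B. le b b'})"
    by (simp add: net_filter_def)
  moreover have "eventually (\<lambda>_. False) (INF b\<in>B. principal {b' \<in> B. le b b'}) \<longleftrightarrow>
    (\<exists>b\<in>B. eventually (\<lambda>_. False) (principal {b' \<in> B. le b b'}))"
  proof (rule eventually_INF_base)
    show "B \<noteq> {}" using assms by (simp add: directed_set_def)
    fix x y assume xy: "x \<in> B" "y \<in> B"
    then obtain z where z: "z \<in> B" "le x z" "le y z" using assms unfolding directed_set_def by blast
    then have "{b' \<in> B. le z b'} \<subseteq> {b' \<in> B. le x b'} \<inter> {b' \<in> B. le y b'}"
      using assms xy unfolding directed_set_def by (blast dest: transp_onD)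
    with z(1) show "\<exists>z\<in>B. principal {b' \<in> B. le z b'} \<le>
        inf (principal {b' \<in> B. le x b'}) (principal {b' \<in> B. le y b'})"
      by auto
  qed
  ultimately show False
    using assms by (auto simp: eventually_principal directed_set_def dest: reflp_onD)
qed

text \<open>Refining the net to an ultrafilter, and setting \<open>e\<close> to zero off the index set, which the ultrafilter
  does not notice, makes membership and the bound hold for every index.\<close>
lemma bounded_approximate_identity_ultrafilter:
  fixes e :: "'i \<Rightarrow> 'a::real_normed_algebra"
  assumes "bounded_approximate_identity I B le e" "0 \<in> I"
  shows "\<exists>(U :: 'i filter) e' E. ultrafilter U \<and> (\<forall>b. e' b \<in> I) \<and> (\<forall>b. norm (e' b) \<le> E) \<and>
    (\<forall>c\<in>I. ((\<lambda>b. e' b * c) \<longlongrightarrow> c) U \<and> ((\<lambda>b. c * e' b) \<longlongrightarrow> c) U)"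
proof -
  have dir: "directed_set B le" and eI: "e ` B \<subseteq> I" and bd: "bounded (e ` B)"
    and lim: "\<And>c. c \<in> I \<Longrightarrow> ((\<lambda>b. e b * c) \<longlongrightarrow> c) (net_filter B le)"
      "\<And>c. c \<in> I \<Longrightarrow> ((\<lambda>b. c * e b) \<longlongrightarrow> c) (net_filter B le)"
    using assms(1) by (auto simp: bounded_approximate_identity_def)
  obtain U where U: "U \<le> net_filter B le" "ultrafilter U"
    using ultrafilter_below[OF net_filter_neq_bot[OF dir]] by blast
  obtain E where E: "0 < E" "\<And>b. b \<in> B \<Longrightarrow> norm (e b) \<le> E"
    using bd by (auto simp: bounded_pos)
  define e' where "e' b = (if b \<in> B then e b else 0)" for b
  obtain b\<^sub>0 where "b\<^sub>0 \<in> B" using dir by (auto simp: directed_set_def)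
  then have "net_filter B le \<le> principal {b' \<in> B. le b\<^sub>0 b'}"
    unfolding net_filter_def by (rule INF_lower)
  also have "\<dots> \<le> principal B" by auto
  finally have "eventually (\<lambda>b. b \<in> B) U" using U(1) by (simp add: le_principal filter_leD)
  then have ev: "eventually (\<lambda>b. e b = e' b) U" by eventually_elim (simp add: e'_def)
  have "((\<lambda>b. e' b * c) \<longlongrightarrow> c) U" "((\<lambda>b. c * e' b) \<longlongrightarrow> c) U" if "c \<in> I" for c
    by (rule Lim_transform_eventually[OF tendsto_mono[OF U(1) lim(1)[OF that]] eventually_mono[OF ev]], simp,
        rule Lim_transform_eventually[OF tendsto_mono[OF U(1) lim(2)[OF that]] eventually_mono[OF ev]], simp)
  moreover have "e' b \<in> I" "norm (e' b) \<le> E" for b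
    using eI E assms(2) by (auto simp: e'_def)
  ultimately show ?thesis
    using U(2) by (intro exI[of _ U] exI[of _ e'] exI[of _ E]) simp
qed

lemma nonneg_bilinear_bound:
  assumes "\<exists>K. \<forall>a\<in>S. \<forall>z\<in>C. f a z \<le> K * norm a * n z" "\<And>z. z \<in> C \<Longrightarrow> 0 \<le> n z"
  shows "\<exists>K\<ge>0. \<forall>a\<in>S. \<forall>z\<in>C. f a z \<le> K * norm a * (n z :: real)"
proof -
  obtain K where K: "\<And>a z. a \<in> S \<Longrightarrow> z \<in> C \<Longrightarrow> f a z \<le> K * norm a * n z" using assms(1) by blast
  have "f a z \<le> \<bar>K\<bar> * norm a * n z" if "a \<in> S" "z \<in> C" for a z
    by (rule order_trans[OF K[OF that]]) (intro mult_right_mono assms(2) that abs_ge_self norm_ge_zero)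
  then show ?thesis by (intro exI[of _ "\<bar>K\<bar>"]) simp
qed

theorem theorem5p1:
  fixes scl :: "'k::{real_normed_field,heine_borel} \<Rightarrow> 'a::{real_normed_algebra,banach} \<Rightarrow> 'a"
    and I :: "'a set"
    and B :: "'i set" and le :: "'i \<Rightarrow> 'i \<Rightarrow> bool" and e :: "'i \<Rightarrow> 'a"
  assumes "banach_algebra scl"
    and "amenable_over TYPE(('k, 'a) bimod_universe) scl UNIV"
    and "closed_left_ideal scl I"
    and "bounded_approximate_identity I B le e"
  shows "amenable_over TYPE('z) scl I"
  unfolding amenable_over_def
proof (intro allI impI)
  fix Z :: "('k, 'a, 'z) bimod" and D
  assume Z: "banach_bimodule scl I Z" and D: "continuous_derivation scl I (dual_bimodule Z) D"
  interpret banach_algebra scl by (rule assms)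
  interpret Z: banach_bimodule scl I Z by (rule Z)
  have sub: "subspace I" and left: "\<And>a x. x \<in> I \<Longrightarrow> a * x \<in> I"
    using assms(3) by (auto simp: closed_left_ideal_def)
  obtain U :: "'i filter" and e' E where e': "ultrafilter U" "\<And>b. e' b \<in> I" "\<And>b. norm (e' b) \<le> E"
    "\<And>c. c \<in> I \<Longrightarrow> ((\<lambda>b. e' b * c) \<longlongrightarrow> c) U" "\<And>c. c \<in> I \<Longrightarrow> ((\<lambda>b. c * e' b) \<longlongrightarrow> c) U"
    using bounded_approximate_identity_ultrafilter[OF assms(4) subspace_0[OF sub]] by blast
  obtain M where M: "virtual_diagonal M"
    using amenable_imp_virtual_diagonal[OF assms(2)] by blast
  obtain K where K: "0 \<le> K" "\<And>a z. a \<in> I \<Longrightarrow> z \<in> vcarrier Z \<Longrightarrow> norm (D a z) \<le> K * norm a * vnorm Z z"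
    using continuous_derivation_bounded[OF Z.banach_space_axioms sub D] by blast
  obtain R where R: "0 \<le> R" "\<And>a z. a \<in> I \<Longrightarrow> z \<in> vcarrier Z \<Longrightarrow> vnorm Z (ract Z z a) \<le> R * norm a * vnorm Z z"
    using nonneg_bilinear_bound[OF Z.ract_bounded Z.norm_nonneg] by blast
  have DZ: "D a \<in> bounded_functionals Z" if "a \<in> I" for a
    using D that by (simp add: continuous_derivation_def dual_bimodule_def)
  interpret ideal_derivation scl I Z U e' E D R K M
  proof
    show "D (x + y) z = D x z + D y z" if "x \<in> I" "y \<in> I" "z \<in> vcarrier Z" for x y z
      using D that by (simp add: continuous_derivation_def dual_bimodule_def)
    show "D (scl k x) z = k * D x z" if "x \<in> I" "z \<in> vcarrier Z" for k x z
      using D that by (simp add: continuous_derivation_def dual_bimodule_def)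
    show "D (x * y) z = D y (ract Z z x) + D x (lact Z y z)" if "x \<in> I" "y \<in> I" "z \<in> vcarrier Z" for x y z
      using D that by (simp add: continuous_derivation_def dual_bimodule_def)
    show "D x (vadd Z y z) = D x y + D x z" if "x \<in> I" "y \<in> vcarrier Z" "z \<in> vcarrier Z" for x y z
      using DZ[OF that(1)] that by (simp add: bounded_functionals_def)
    show "D x (vscale Z k z) = k * D x z" if "x \<in> I" "z \<in> vcarrier Z" for k x z
      using DZ[OF that(1)] that by (simp add: bounded_functionals_def)
  qed (fact sub left e' K R M)+
  obtain f where f: "functional f"
    and df: "\<And>c z. c \<in> I \<Longrightarrow> z \<in> vcarrier Z \<Longrightarrow> D c z = f (ract Z z c) - f (lact Z c z)"
    using derivation_is_inner by blast
  show "inner_derivation I (dual_bimodule Z) D"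
    unfolding inner_derivation_def
  proof (intro bexI ballI)
    let ?f = "restrict f (vcarrier Z)"
    show "?f \<in> vcarrier (dual_bimodule Z)"
      using f by (simp add: functional_def dual_bimodule_def)
    fix c assume c: "c \<in> I"
    show "D c = vdiff (dual_bimodule Z) (lact (dual_bimodule Z) c ?f) (ract (dual_bimodule Z) ?f c)"
    proof (rule extensionalityI[of _ "vcarrier Z"])
      show "D c \<in> extensional (vcarrier Z)" using DZ[OF c] by (simp add: bounded_functionals_def)
    qed (simp_all add: vdiff_def dual_bimodule_def df c Z.lact_closed Z.ract_closed)
  qed
qed

end
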